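(* Let $\Lambda$ be a left-artinian ring, $\mathcal{C}=\mathrm{mod}(\Lambda)$, and let $\alpha,\beta$ be pre-radicals on $\mathcal{C}$ such that $\alpha^2=\alpha$ and $q_\beta$ preserves monomorphisms. Then $\ell\ell^\alpha(M)\leq\ell\ell_{q_\beta}(M)$ for every $M\in\mathcal{C}$ if and only if $\mathcal{T}_\beta\subseteq\mathcal{F}_\alpha$.
   Context: $\mathcal{C}$ is the category of finitely generated left $\Lambda$-modules; $\mathrm{rad}$, $\mathrm{soc}$ are the radical and socle functors. A pre-radical is an additive subfunctor $\alpha$ of the identity; $q_\alpha:=\mathrm{Id}/\alpha$. $\mathcal{F}_\alpha=\{M:\alpha(M)=0\}$, $\mathcal{T}_\alpha=\{M:\alpha(M)=M\}$. For an additive functor $\gamma$, $F_\gamma=\mathrm{rad}\circ\gamma$, $G_\gamma=\gamma/(\mathrm{soc}\circ\gamma)$, $\ell\ell^\gamma(M)=\min\{i\geq0:\gamma\circ F_\gamma^{\,i}(M)=0\}$ and $\ell\ell_\gamma(M)=\min\{i\geq0:\gamma\circ G_\gamma^{\,i}(M)=0\}$ (with $\min\emptyset=\infty$). *)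

theory Defs
  imports "HOL-Algebra.Module" "HOL-Algebra.AbelCoset" "HOL-Library.Extended_Nat"
begin

definition lmodule :: "'a ring \<Rightarrow> ('a, 'u) module \<Rightarrow> bool" where
  "lmodule R M \<longleftrightarrow> ring R \<and> abelian_group M \<and>
     (\<forall>a\<in>carrier R. \<forall>x\<in>carrier M. a \<odot>\<^bsub>M\<^esub> x \<in> carrier M) \<and>
     (\<forall>a\<in>carrier R. \<forall>b\<in>carrier R. \<forall>x\<in>carrier M.
        (a \<oplus>\<^bsub>R\<^esub> b) \<odot>\<^bsub>M\<^esub> x = a \<odot>\<^bsub>M\<^esub> x \<oplus>\<^bsub>M\<^esub> b \<odot>\<^bsub>M\<^esub> x) \<and>
     (\<forall>a\<in>carrier R. \<forall>x\<in>carrier M. \<forall>y\<in>carrier M.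
        a \<odot>\<^bsub>M\<^esub> (x \<oplus>\<^bsub>M\<^esub> y) = a \<odot>\<^bsub>M\<^esub> x \<oplus>\<^bsub>M\<^esub> a \<odot>\<^bsub>M\<^esub> y) \<and>
     (\<forall>a\<in>carrier R. \<forall>b\<in>carrier R. \<forall>x\<in>carrier M.
        (a \<otimes>\<^bsub>R\<^esub> b) \<odot>\<^bsub>M\<^esub> x = a \<odot>\<^bsub>M\<^esub> (b \<odot>\<^bsub>M\<^esub> x)) \<and>
     (\<forall>x\<in>carrier M. \<one>\<^bsub>R\<^esub> \<odot>\<^bsub>M\<^esub> x = x)"

definition is_submod :: "'a ring \<Rightarrow> ('a, 'u) module \<Rightarrow> 'u set \<Rightarrow> bool" where
  "is_submod R M N \<longleftrightarrow> N \<subseteq> carrier M \<and> \<zero>\<^bsub>M\<^esub> \<in> N \<and>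
     (\<forall>x\<in>N. \<forall>y\<in>N. x \<oplus>\<^bsub>M\<^esub> y \<in> N) \<and> (\<forall>x\<in>N. \<ominus>\<^bsub>M\<^esub> x \<in> N) \<and>
     (\<forall>r\<in>carrier R. \<forall>x\<in>N. r \<odot>\<^bsub>M\<^esub> x \<in> N)"

definition submod :: "('a, 'u) module \<Rightarrow> 'u set \<Rightarrow> ('a, 'u) module" where
  "submod M N = M\<lparr>carrier := N\<rparr>"

definition gen_submod :: "'a ring \<Rightarrow> ('a, 'u) module \<Rightarrow> 'u set \<Rightarrow> 'u set" where
  "gen_submod R M S = \<Inter>{N. is_submod R M N \<and> S \<subseteq> N}"

definition fg_mod :: "'a ring \<Rightarrow> ('a, 'u) module \<Rightarrow> bool" where
  "fg_mod R M \<longleftrightarrow> lmodule R M \<and>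
     (\<exists>S. finite S \<and> S \<subseteq> carrier M \<and> gen_submod R M S = carrier M)"

definition simple_submod :: "'a ring \<Rightarrow> ('a, 'u) module \<Rightarrow> 'u set \<Rightarrow> bool" where
  "simple_submod R M N \<longleftrightarrow> is_submod R M N \<and> N \<noteq> {\<zero>\<^bsub>M\<^esub>} \<and>
     (\<forall>K. is_submod R M K \<and> K \<subseteq> N \<longrightarrow> K = {\<zero>\<^bsub>M\<^esub>} \<or> K = N)"

definition maximal_submod :: "'a ring \<Rightarrow> ('a, 'u) module \<Rightarrow> 'u set \<Rightarrow> bool" where
  "maximal_submod R M N \<longleftrightarrow> is_submod R M N \<and> N \<noteq> carrier M \<and>
     (\<forall>K. is_submod R M K \<and> N \<subseteq> K \<longrightarrow> K = N \<or> K = carrier M)"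

definition rad :: "'a ring \<Rightarrow> ('a, 'u) module \<Rightarrow> 'u set" where
  "rad R M = \<Inter>({carrier M} \<union> {N. maximal_submod R M N})"

definition soc :: "'a ring \<Rightarrow> ('a, 'u) module \<Rightarrow> 'u set" where
  "soc R M = gen_submod R M (\<Union>{N. simple_submod R M N})"

definition mod_hom :: "'a ring \<Rightarrow> ('a, 'u) module \<Rightarrow> ('a, 'u) module \<Rightarrow> ('u \<Rightarrow> 'u) \<Rightarrow> bool" where
  "mod_hom R M N f \<longleftrightarrow> f \<in> carrier M \<rightarrow> carrier N \<and>
     (\<forall>x\<in>carrier M. \<forall>y\<in>carrier M. f (x \<oplus>\<^bsub>M\<^esub> y) = f x \<oplus>\<^bsub>N\<^esub> f y) \<and>
     (\<forall>r\<in>carrier R. \<forall>x\<in>carrier M. f (r \<odot>\<^bsub>M\<^esub> x) = r \<odot>\<^bsub>N\<^esub> f x)"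

text \<open>Quotient module M/L, realised on a set of coset representatives (so that it
  lives in the same carrier type as M).\<close>
definition qrep :: "('a, 'u) module \<Rightarrow> 'u set \<Rightarrow> 'u \<Rightarrow> 'u" where
  "qrep M L x = (SOME y. y \<in> a_r_coset M L x)"

definition quotmod :: "('a, 'u) module \<Rightarrow> 'u set \<Rightarrow> ('a, 'u) module" where
  "quotmod M L = \<lparr>carrier = qrep M L ` carrier M, monoid.mult = monoid.mult M,
      one = one M, zero = qrep M L (zero M),
      add = (\<lambda>x y. qrep M L (x \<oplus>\<^bsub>M\<^esub> y)),
      smult = (\<lambda>r x. qrep M L (r \<odot>\<^bsub>M\<^esub> x))\<rparr>"

definition pre_radical :: "'a ring \<Rightarrow> (('a, 'u) module \<Rightarrow> 'u set) \<Rightarrow> bool" where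
  "pre_radical R \<alpha> \<longleftrightarrow> (\<forall>M. fg_mod R M \<longrightarrow> is_submod R M (\<alpha> M)) \<and>
     (\<forall>M N f. fg_mod R M \<and> fg_mod R N \<and> mod_hom R M N f \<longrightarrow> f ` \<alpha> M \<subseteq> \<alpha> N)"

definition qfun :: "(('a, 'u) module \<Rightarrow> 'u set) \<Rightarrow> ('a, 'u) module \<Rightarrow> ('a, 'u) module" where
  "qfun \<alpha> M = quotmod M (\<alpha> M)"

definition Ffun :: "'a ring \<Rightarrow> (('a, 'u) module \<Rightarrow> 'u set) \<Rightarrow> ('a, 'u) module \<Rightarrow> ('a, 'u) module" where
  "Ffun R \<alpha> M = submod M (rad R (submod M (\<alpha> M)))"

definition Gfun :: "'a ring \<Rightarrow> (('a, 'u) module \<Rightarrow> 'u set) \<Rightarrow> ('a, 'u) module \<Rightarrow> ('a, 'u) module" where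
  "Gfun R \<beta> M = quotmod (qfun \<beta> M) (soc R (qfun \<beta> M))"

definition ll_up :: "'a ring \<Rightarrow> (('a, 'u) module \<Rightarrow> 'u set) \<Rightarrow> ('a, 'u) module \<Rightarrow> enat" where
  "ll_up R \<alpha> M =
    (if \<exists>i. \<alpha> ((Ffun R \<alpha> ^^ i) M) = {zero ((Ffun R \<alpha> ^^ i) M)}
     then enat (LEAST i. \<alpha> ((Ffun R \<alpha> ^^ i) M) = {zero ((Ffun R \<alpha> ^^ i) M)})
     else \<infinity>)"

definition ll_low_q :: "'a ring \<Rightarrow> (('a, 'u) module \<Rightarrow> 'u set) \<Rightarrow> ('a, 'u) module \<Rightarrow> enat" where
  "ll_low_q R \<beta> M =
    (if \<exists>i. carrier (qfun \<beta> ((Gfun R \<beta> ^^ i) M)) = {zero (qfun \<beta> ((Gfun R \<beta> ^^ i) M))}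
     then enat (LEAST i. carrier (qfun \<beta> ((Gfun R \<beta> ^^ i) M))
                         = {zero (qfun \<beta> ((Gfun R \<beta> ^^ i) M))})
     else \<infinity>)"

definition left_ideal :: "'a ring \<Rightarrow> 'a set \<Rightarrow> bool" where
  "left_ideal R I \<longleftrightarrow> I \<subseteq> carrier R \<and> \<zero>\<^bsub>R\<^esub> \<in> I \<and>
     (\<forall>x\<in>I. \<forall>y\<in>I. x \<oplus>\<^bsub>R\<^esub> y \<in> I) \<and> (\<forall>x\<in>I. \<ominus>\<^bsub>R\<^esub> x \<in> I) \<and>
     (\<forall>r\<in>carrier R. \<forall>x\<in>I. r \<otimes>\<^bsub>R\<^esub> x \<in> I)"

definition left_artinian :: "'a ring \<Rightarrow> bool" where
  "left_artinian R \<longleftrightarrow> ring R \<and>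
     (\<forall>I :: nat \<Rightarrow> 'a set. (\<forall>n. left_ideal R (I n) \<and> I (Suc n) \<subseteq> I n) \<longrightarrow>
        (\<exists>n. \<forall>m\<ge>n. I m = I n))"

end

(*
If T_beta is contained in F_alpha, then every hom from a module T with alpha T = T kills beta-torsion:
beta is idempotent because q_beta preserves monomorphisms, so beta N lies in T_beta, hence in F_alpha.
Let p_i : M -> G^i M be the canonical maps and suppose beta (G^n M) = G^n M. By induction on j,
p_(n-j) maps Y = F^j M into beta (G^(n-j) M): as alpha is idempotent, p_(n-j) kills alpha Y, so
alpha Y is mapped into the socle of q_beta (G^(n-j-1) M), and therefore rad (alpha Y) to 0 in
q_beta (G^(n-j-1) M). For j = n this gives F^n M <= beta M, whence alpha (F^n M) = 0.

All of this needs submodules of finitely generated modules to be finitely generated. Since a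
finitely generated module has the descending chain condition, this reduces to the fact that every
nonzero module over a left artinian ring has a maximal submodule.
*)

theory Submission
  imports Defs
begin

text \<open>Pre-radicals are controlled on finitely generated modules only, so nothing is known
  about \<open>\<alpha>\<close> on \<open>F^j M\<close> before \<open>F^j M\<close> is seen to be
  finitely generated. The obstacle is that a maximal submodule must be found in a module not known
  to be finitely generated. There Zorn's lemma on proper submodules fails, as a union of a chain of
  them can be everything; what survives such unions is avoiding a fixed element \<open>x\<close>. A
  submodule containing \<open>K\<close> and maximal among those avoiding \<open>x\<close> is truly
  maximal as soon as the module is generated over \<open>K\<close> by pieces that are zero or simple
  modulo \<open>K\<close>. This criterion is used twice. Over a left artinian ring the pieces are
  the \<open>L y\<close>, where \<open>L\<close> is minimal among the left ideals with
  \<open>L M = M\<close>, and \<open>K = L' M\<close> for a maximal left subideal \<open>L'\<close>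
  of \<open>L\<close>. In a socle the pieces are the simple submodules and \<open>K = 0\<close>;
  there it shows that a socle has zero radical, which is why a map into a socle kills the radical of
  its source.\<close>

section \<open>Left modules, submodules and generated submodules\<close>

locale lmod =
  fixes R :: "'a ring" and M :: "('a, 'u) module"
  assumes lmodule: "lmodule R M"
begin

sublocale R: ring R
  using lmodule by (simp add: lmodule_def)

sublocale abelian_group M
  using lmodule by (simp add: lmodule_def)

lemma smult_closed [simp, intro]:
  "a \<in> carrier R \<Longrightarrow> x \<in> carrier M \<Longrightarrow> a \<odot>\<^bsub>M\<^esub> x \<in> carrier M"
  using lmodule by (simp add: lmodule_def)

lemma smult_l_distr:
  "a \<in> carrier R \<Longrightarrow> b \<in> carrier R \<Longrightarrow> x \<in> carrier M \<Longrightarrow>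
    (a \<oplus>\<^bsub>R\<^esub> b) \<odot>\<^bsub>M\<^esub> x = a \<odot>\<^bsub>M\<^esub> x \<oplus>\<^bsub>M\<^esub> b \<odot>\<^bsub>M\<^esub> x"
  using lmodule by (simp add: lmodule_def)

lemma smult_r_distr:
  "a \<in> carrier R \<Longrightarrow> x \<in> carrier M \<Longrightarrow> y \<in> carrier M \<Longrightarrow>
    a \<odot>\<^bsub>M\<^esub> (x \<oplus>\<^bsub>M\<^esub> y) = a \<odot>\<^bsub>M\<^esub> x \<oplus>\<^bsub>M\<^esub> a \<odot>\<^bsub>M\<^esub> y"
  using lmodule by (simp add: lmodule_def)

lemma smult_assoc:
  "a \<in> carrier R \<Longrightarrow> b \<in> carrier R \<Longrightarrow> x \<in> carrier M \<Longrightarrow>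
    (a \<otimes>\<^bsub>R\<^esub> b) \<odot>\<^bsub>M\<^esub> x = a \<odot>\<^bsub>M\<^esub> (b \<odot>\<^bsub>M\<^esub> x)"
  using lmodule by (simp add: lmodule_def)

lemma smult_one [simp]: "x \<in> carrier M \<Longrightarrow> \<one>\<^bsub>R\<^esub> \<odot>\<^bsub>M\<^esub> x = x"
  using lmodule by (simp add: lmodule_def)

lemma smult_l_null [simp]: "x \<in> carrier M \<Longrightarrow> \<zero>\<^bsub>R\<^esub> \<odot>\<^bsub>M\<^esub> x = \<zero>\<^bsub>M\<^esub>"
  by (metis R.zero_closed R.l_zero smult_l_distr smult_closed add.r_cancel_one)

lemma smult_r_null [simp]: "a \<in> carrier R \<Longrightarrow> a \<odot>\<^bsub>M\<^esub> \<zero>\<^bsub>M\<^esub> = \<zero>\<^bsub>M\<^esub>"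
  by (metis zero_closed l_zero smult_r_distr smult_closed add.r_cancel_one)

lemma smult_minus_one: 
  assumes "x \<in> carrier M" shows "(\<ominus>\<^bsub>R\<^esub> \<one>\<^bsub>R\<^esub>) \<odot>\<^bsub>M\<^esub> x = \<ominus>\<^bsub>M\<^esub> x"
proof -
  have "(\<ominus>\<^bsub>R\<^esub> \<one>\<^bsub>R\<^esub>) \<odot>\<^bsub>M\<^esub> x \<oplus>\<^bsub>M\<^esub> x = (\<ominus>\<^bsub>R\<^esub> \<one>\<^bsub>R\<^esub> \<oplus>\<^bsub>R\<^esub> \<one>\<^bsub>R\<^esub>) \<odot>\<^bsub>M\<^esub> x"
    using assms by (subst smult_l_distr) auto
  also have "\<dots> = \<zero>\<^bsub>M\<^esub>" using assms by (simp add: R.l_neg)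
  finally show ?thesis using assms by (intro minus_equality [symmetric]) auto
qed

lemma is_submodI:
  assumes "N \<subseteq> carrier M" "\<zero>\<^bsub>M\<^esub> \<in> N" "\<And>x y. x \<in> N \<Longrightarrow> y \<in> N \<Longrightarrow> x \<oplus>\<^bsub>M\<^esub> y \<in> N"
    "\<And>r x. r \<in> carrier R \<Longrightarrow> x \<in> N \<Longrightarrow> r \<odot>\<^bsub>M\<^esub> x \<in> N"
  shows "is_submod R M N"
  unfolding is_submod_def
proof (intro conjI ballI)
  fix x assume "x \<in> N"
  then show "\<ominus>\<^bsub>M\<^esub> x \<in> N"
    using assms(1) assms(4)[of "\<ominus>\<^bsub>R\<^esub> \<one>\<^bsub>R\<^esub>" x] smult_minus_one[of x] by auto
qed (use assms in auto)

lemma is_submod_carrier: "is_submod R M (carrier M)"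
  by (rule is_submodI) auto

lemma is_submod_zero: "is_submod R M {\<zero>\<^bsub>M\<^esub>}"
  by (rule is_submodI) auto

end

lemma
  assumes "is_submod R M N"
  shows is_submod_subset: "N \<subseteq> carrier M"
    and is_submod_zero_mem: "\<zero>\<^bsub>M\<^esub> \<in> N"
    and is_submod_add: "x \<in> N \<Longrightarrow> y \<in> N \<Longrightarrow> x \<oplus>\<^bsub>M\<^esub> y \<in> N"
    and is_submod_neg: "x \<in> N \<Longrightarrow> \<ominus>\<^bsub>M\<^esub> x \<in> N"
    and is_submod_smult: "r \<in> carrier R \<Longrightarrow> x \<in> N \<Longrightarrow> r \<odot>\<^bsub>M\<^esub> x \<in> N"
    and is_submod_carrierD: "x \<in> N \<Longrightarrow> x \<in> carrier M"
  using assms by (auto simp: is_submod_def)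

context lmod
begin

lemma is_submod_add_cancel:
  assumes "is_submod R M N" "x \<in> N" "y \<in> carrier M" "x \<oplus>\<^bsub>M\<^esub> y \<in> N"
  shows "y \<in> N"
proof -
  have "\<ominus>\<^bsub>M\<^esub> x \<oplus>\<^bsub>M\<^esub> (x \<oplus>\<^bsub>M\<^esub> y) \<in> N"
    using assms by (meson is_submod_add is_submod_neg)
  moreover have "\<ominus>\<^bsub>M\<^esub> x \<oplus>\<^bsub>M\<^esub> (x \<oplus>\<^bsub>M\<^esub> y) = y"
    using assms is_submod_carrierD[OF assms(1,2)] by (simp add: r_neg1)
  ultimately show ?thesis by simp
qed

lemma is_submod_Inter:
  assumes "\<N> \<noteq> {}" "\<And>N. N \<in> \<N> \<Longrightarrow> is_submod R M N"
  shows "is_submod R M (\<Inter>\<N>)"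
  by (rule is_submodI)
    (use assms in \<open>auto dest: is_submod_zero_mem is_submod_add is_submod_smult is_submod_carrierD\<close>)

lemma is_submod_Int:
  "is_submod R M A \<Longrightarrow> is_submod R M B \<Longrightarrow> is_submod R M (A \<inter> B)"
  using is_submod_Inter[of "{A, B}"] by auto

lemma is_submod_gen: "S \<subseteq> carrier M \<Longrightarrow> is_submod R M (gen_submod R M S)"
  unfolding gen_submod_def by (rule is_submod_Inter) (use is_submod_carrier in auto)

lemma gen_submod_superset: "S \<subseteq> gen_submod R M S"
  by (auto simp: gen_submod_def)

lemma gen_submod_least: "is_submod R M N \<Longrightarrow> S \<subseteq> N \<Longrightarrow> gen_submod R M S \<subseteq> N"
  by (auto simp: gen_submod_def)

lemma is_submod_set_add:
  assumes A: "is_submod R M A" and B: "is_submod R M B"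
  shows "is_submod R M (A <+>\<^bsub>M\<^esub> B)"
proof (rule is_submodI)
  note c = is_submod_carrierD[OF A] is_submod_carrierD[OF B]
  show "A <+>\<^bsub>M\<^esub> B \<subseteq> carrier M" using c by (auto simp: set_add_def')
  have "\<zero>\<^bsub>M\<^esub> = \<zero>\<^bsub>M\<^esub> \<oplus>\<^bsub>M\<^esub> \<zero>\<^bsub>M\<^esub>" by simp
  then show "\<zero>\<^bsub>M\<^esub> \<in> A <+>\<^bsub>M\<^esub> B"
    unfolding set_add_def' using is_submod_zero_mem[OF A] is_submod_zero_mem[OF B] by blast
  fix x assume "x \<in> A <+>\<^bsub>M\<^esub> B"
  then obtain a b where x: "x = a \<oplus>\<^bsub>M\<^esub> b" "a \<in> A" "b \<in> B" by (auto simp: set_add_def')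
  { fix y assume "y \<in> A <+>\<^bsub>M\<^esub> B"
    then obtain c d where y: "y = c \<oplus>\<^bsub>M\<^esub> d" "c \<in> A" "d \<in> B" by (auto simp: set_add_def')
    have "x \<oplus>\<^bsub>M\<^esub> y = (a \<oplus>\<^bsub>M\<^esub> c) \<oplus>\<^bsub>M\<^esub> (b \<oplus>\<^bsub>M\<^esub> d)"
      using x y c by (simp add: a_ac)
    then show "x \<oplus>\<^bsub>M\<^esub> y \<in> A <+>\<^bsub>M\<^esub> B"
      unfolding set_add_def' using is_submod_add[OF A x(2) y(2)] is_submod_add[OF B x(3) y(3)] by blast }
  { fix r assume r: "r \<in> carrier R"
    then have "r \<odot>\<^bsub>M\<^esub> x = r \<odot>\<^bsub>M\<^esub> a \<oplus>\<^bsub>M\<^esub> r \<odot>\<^bsub>M\<^esub> b"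
      using x c by (simp add: smult_r_distr)
    then show "r \<odot>\<^bsub>M\<^esub> x \<in> A <+>\<^bsub>M\<^esub> B"
      unfolding set_add_def' using is_submod_smult[OF A r x(2)] is_submod_smult[OF B r x(3)] by blast }
qed

lemma set_add_upper1:
  assumes "is_submod R M A" "is_submod R M B"
  shows "A \<subseteq> A <+>\<^bsub>M\<^esub> B"
proof
  fix a assume "a \<in> A"
  moreover from this have "a = a \<oplus>\<^bsub>M\<^esub> \<zero>\<^bsub>M\<^esub>" using is_submod_carrierD[OF assms(1)] by simp
  ultimately show "a \<in> A <+>\<^bsub>M\<^esub> B"
    unfolding set_add_def' using is_submod_zero_mem[OF assms(2)] by blast
qed

lemma set_add_upper2:
  assumes "is_submod R M A" "is_submod R M B"
  shows "B \<subseteq> A <+>\<^bsub>M\<^esub> B"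
proof
  fix a assume "a \<in> B"
  moreover from this have "a = \<zero>\<^bsub>M\<^esub> \<oplus>\<^bsub>M\<^esub> a" using is_submod_carrierD[OF assms(2)] by simp
  ultimately show "a \<in> A <+>\<^bsub>M\<^esub> B"
    unfolding set_add_def' using is_submod_zero_mem[OF assms(1)] by blast
qed

lemma is_submod_smult_image:
  assumes "left_ideal R L" "y \<in> carrier M"
  shows "is_submod R M ((\<lambda>l. l \<odot>\<^bsub>M\<^esub> y) ` L)"
proof (rule is_submodI)
  note L = assms(1)[unfolded left_ideal_def]
  show "(\<lambda>l. l \<odot>\<^bsub>M\<^esub> y) ` L \<subseteq> carrier M" using L assms(2) by auto
  show "\<zero>\<^bsub>M\<^esub> \<in> (\<lambda>l. l \<odot>\<^bsub>M\<^esub> y) ` L"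
    using L assms(2) by (auto intro!: image_eqI[of _ _ "\<zero>\<^bsub>R\<^esub>"])
  fix u assume "u \<in> (\<lambda>l. l \<odot>\<^bsub>M\<^esub> y) ` L"
  then obtain a where a: "a \<in> L" "u = a \<odot>\<^bsub>M\<^esub> y" by auto
  { fix v assume "v \<in> (\<lambda>l. l \<odot>\<^bsub>M\<^esub> y) ` L"
    then obtain b where b: "b \<in> L" "v = b \<odot>\<^bsub>M\<^esub> y" by auto
    show "u \<oplus>\<^bsub>M\<^esub> v \<in> (\<lambda>l. l \<odot>\<^bsub>M\<^esub> y) ` L"
      using a b L assms(2) by (intro image_eqI[of _ _ "a \<oplus>\<^bsub>R\<^esub> b"]) (auto simp: smult_l_distr subsetD) }
  { fix r assume "r \<in> carrier R"
    then show "r \<odot>\<^bsub>M\<^esub> u \<in> (\<lambda>l. l \<odot>\<^bsub>M\<^esub> y) ` L"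
      using a L assms(2) by (intro image_eqI[of _ _ "r \<otimes>\<^bsub>R\<^esub> a"]) (auto simp: smult_assoc subsetD) }
qed

lemma left_ideal_carrier: "left_ideal R (carrier R)"
  by (auto simp: left_ideal_def)

lemma left_ideal_colon:
  assumes "is_submod R M Q" "y \<in> carrier M"
  shows "left_ideal R {r \<in> carrier R. r \<odot>\<^bsub>M\<^esub> y \<in> Q}"
  unfolding left_ideal_def
proof (intro conjI ballI)
  fix x assume x: "x \<in> {r \<in> carrier R. r \<odot>\<^bsub>M\<^esub> y \<in> Q}"
  have "(\<ominus>\<^bsub>R\<^esub> x) \<odot>\<^bsub>M\<^esub> y = (\<ominus>\<^bsub>R\<^esub> \<one>\<^bsub>R\<^esub>) \<odot>\<^bsub>M\<^esub> (x \<odot>\<^bsub>M\<^esub> y)"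
    using x assms(2) by (subst smult_assoc [symmetric]) (auto simp: R.l_minus)
  then show "\<ominus>\<^bsub>R\<^esub> x \<in> {r \<in> carrier R. r \<odot>\<^bsub>M\<^esub> y \<in> Q}"
    using x is_submod_smult[OF assms(1), of "\<ominus>\<^bsub>R\<^esub> \<one>\<^bsub>R\<^esub>"] by auto
qed (use assms in \<open>auto simp: smult_l_distr smult_assoc
    dest: is_submod_zero_mem is_submod_add is_submod_smult\<close>)

section \<open>Maximal submodules obtained by avoiding an element\<close>

lemma exists_maximal_avoiding:
  assumes "is_submod R M K" "x \<notin> K"
  obtains P where "is_submod R M P" "K \<subseteq> P" "x \<notin> P"
    "\<And>Q. is_submod R M Q \<Longrightarrow> P \<subseteq> Q \<Longrightarrow> Q \<noteq> P \<Longrightarrow> x \<in> Q"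
proof -
  let ?A = "{P. is_submod R M P \<and> K \<subseteq> P \<and> x \<notin> P}"
  have "\<exists>P\<in>?A. \<forall>X\<in>?A. P \<subseteq> X \<longrightarrow> X = P"
  proof (rule subset_Zorn_nonempty)
    show "?A \<noteq> {}" using assms by auto
    fix C assume "C \<noteq> {}" and ch: "subset.chain ?A C"
    then have C: "\<And>X. X \<in> C \<Longrightarrow> is_submod R M X \<and> K \<subseteq> X \<and> x \<notin> X"
      by (auto simp: subset_chain_def)
    have "is_submod R M (\<Union>C)"
    proof (rule is_submodI)
      show "\<Union>C \<subseteq> carrier M" using C is_submod_subset by blast
      show "\<zero>\<^bsub>M\<^esub> \<in> \<Union>C" using C \<open>C \<noteq> {}\<close> is_submod_zero_mem by blast
      show "r \<odot>\<^bsub>M\<^esub> u \<in> \<Union>C" if "r \<in> carrier R" "u \<in> \<Union>C" for r u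
        using C that by (auto intro: is_submod_smult)
      show "u \<oplus>\<^bsub>M\<^esub> v \<in> \<Union>C" if "u \<in> \<Union>C" "v \<in> \<Union>C" for u v
      proof -
        obtain X Y where XY: "X \<in> C" "u \<in> X" "Y \<in> C" "v \<in> Y" using \<open>u \<in> \<Union>C\<close> \<open>v \<in> \<Union>C\<close> by auto
        then have "X \<subseteq> Y \<or> Y \<subseteq> X" using ch by (auto simp: subset_chain_def)
        then obtain Z where "Z \<in> C" "u \<in> Z" "v \<in> Z" using XY by blast
        then show ?thesis using C[of Z] by (auto intro: is_submod_add)
      qed
    qed
    then show "\<Union>C \<in> ?A" using C \<open>C \<noteq> {}\<close> by blast
  qed
  then obtain P where P: "P \<in> ?A" "\<forall>X\<in>?A. P \<subseteq> X \<longrightarrow> X = P" ..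
  show ?thesis
  proof (rule that)
    show "x \<in> Q" if "is_submod R M Q" "P \<subseteq> Q" "Q \<noteq> P" for Q
      using P that by auto
  qed (use P(1) in auto)
qed

text \<open>If \<open>M\<close> is generated over \<open>K\<close> by submodules that are zero or simple modulo \<open>K\<close>,
  then a submodule maximal among those avoiding \<open>x\<close> is automatically a maximal submodule.\<close>

lemma exists_maximal_submod_avoiding:
  assumes K: "is_submod R M K" and x: "x \<in> carrier M" "x \<notin> K"
    and T: "\<And>T. T \<in> \<T> \<Longrightarrow> is_submod R M T"
    and gen: "\<And>Q. is_submod R M Q \<Longrightarrow> K \<subseteq> Q \<Longrightarrow> (\<And>T. T \<in> \<T> \<Longrightarrow> T \<subseteq> Q) \<Longrightarrow> Q = carrier M"
    and simple: "\<And>T Q. T \<in> \<T> \<Longrightarrow> is_submod R M Q \<Longrightarrow> K \<subseteq> Q \<Longrightarrow> T \<subseteq> Q \<or> T \<inter> Q \<subseteq> K"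
  shows "\<exists>P. maximal_submod R M P \<and> K \<subseteq> P \<and> x \<notin> P"
proof -
  obtain P where P: "is_submod R M P" "K \<subseteq> P" "x \<notin> P"
    and max: "\<And>Q. is_submod R M Q \<Longrightarrow> P \<subseteq> Q \<Longrightarrow> Q \<noteq> P \<Longrightarrow> x \<in> Q"
    using exists_maximal_avoiding[OF K x(2)] by metis
  have "Q = carrier M" if Q: "is_submod R M Q" "P \<subseteq> Q" "Q \<noteq> P" for Q
  proof (rule gen[OF Q(1)])
    show "K \<subseteq> Q" using P Q by auto
    fix S assume S: "S \<in> \<T>"
    show "S \<subseteq> Q"
    proof (cases "S \<subseteq> P")
      case False
      let ?PS = "P <+>\<^bsub>M\<^esub> S"
      \<comment> \<open>Both \<open>P + S\<close> and \<open>Q\<close> lie strictly above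
        \<open>P\<close>, so both contain \<open>x\<close>. Writing \<open>x = p + t\<close> puts
        \<open>t\<close> in \<open>S\<close> and in \<open>Q\<close>. It is not in \<open>K\<close>,
        since otherwise \<open>x\<close> would be in \<open>P\<close>; hence \<open>S\<close> meets
        \<open>Q\<close> outside \<open>K\<close>.\<close>
      have "P \<subseteq> ?PS" "S \<subseteq> ?PS"
        using set_add_upper1 set_add_upper2 P(1) T[OF S] by auto
      moreover from this have "?PS \<noteq> P" using False by auto
      ultimately have "x \<in> ?PS" using max is_submod_set_add P(1) T[OF S] by blast
      then obtain p t where pt: "p \<in> P" "t \<in> S" "x = p \<oplus>\<^bsub>M\<^esub> t" by (auto simp: set_add_def')
      have "x \<in> Q" using max Q by blast
      then have "t \<in> Q"
        using is_submod_add_cancel[OF Q(1), of p t] pt Q(2) is_submod_carrierD[OF T[OF S]] by auto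
      moreover have "t \<notin> K"
        using pt P is_submod_add[OF P(1)] by blast
      ultimately show ?thesis using simple[OF S Q(1) \<open>K \<subseteq> Q\<close>] pt by blast
    qed (use Q in auto)
  qed
  then show ?thesis using P x unfolding maximal_submod_def by blast
qed

text \<open>The product \<open>L M\<close>; taking the generated submodule replaces explicit finite
  sums.\<close>

definition ideal_smult :: "'a set \<Rightarrow> 'u set" where
  "ideal_smult L = gen_submod R M {l \<odot>\<^bsub>M\<^esub> y | l y. l \<in> L \<and> y \<in> carrier M}"

lemma is_submod_ideal_smult: "L \<subseteq> carrier R \<Longrightarrow> is_submod R M (ideal_smult L)"
  unfolding ideal_smult_def by (rule is_submod_gen) auto

lemma ideal_smult_mem: "l \<in> L \<Longrightarrow> y \<in> carrier M \<Longrightarrow> l \<odot>\<^bsub>M\<^esub> y \<in> ideal_smult L"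
  unfolding ideal_smult_def by (rule subsetD[OF gen_submod_superset]) auto

lemma ideal_smult_least:
  "is_submod R M Q \<Longrightarrow> (\<And>l y. l \<in> L \<Longrightarrow> y \<in> carrier M \<Longrightarrow> l \<odot>\<^bsub>M\<^esub> y \<in> Q) \<Longrightarrow> ideal_smult L \<subseteq> Q"
  unfolding ideal_smult_def by (rule gen_submod_least) auto

lemma ideal_smult_carrier: "ideal_smult (carrier R) = carrier M"
proof
  show "ideal_smult (carrier R) \<subseteq> carrier M"
    by (rule ideal_smult_least[OF is_submod_carrier]) auto
  show "carrier M \<subseteq> ideal_smult (carrier R)"
    using ideal_smult_mem[of "\<one>\<^bsub>R\<^esub>" "carrier R"] by auto
qed

text \<open>The map \<open>l -> l y\<close> makes \<open>L y\<close> modulo \<open>L' M\<close> a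
  quotient of the simple module \<open>L / L'\<close>, so it is zero or simple. These pieces
  generate \<open>M = L M\<close> over \<open>L' M\<close>.\<close>

lemma exists_maximal_submod_of_maximal_ideal:
  assumes L: "left_ideal R L" "ideal_smult L = carrier M"
    and L': "left_ideal R L'" "L' \<subseteq> L" "ideal_smult L' \<noteq> carrier M"
    and max: "\<And>I. left_ideal R I \<Longrightarrow> L' \<subseteq> I \<Longrightarrow> I \<subseteq> L \<Longrightarrow> I = L' \<or> I = L"
  shows "\<exists>P. maximal_submod R M P"
proof -
  let ?K = "ideal_smult L'" and ?T = "{(\<lambda>l. l \<odot>\<^bsub>M\<^esub> y) ` L | y. y \<in> carrier M}"
  have K: "is_submod R M ?K" using L'(1) by (intro is_submod_ideal_smult) (auto simp: left_ideal_def)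
  then obtain x where x: "x \<in> carrier M" "x \<notin> ?K" using L'(3) is_submod_subset by blast
  have "\<exists>P. maximal_submod R M P \<and> ?K \<subseteq> P \<and> x \<notin> P"
  proof (rule exists_maximal_submod_avoiding[OF K x, where \<T> = ?T])
    fix S assume "S \<in> ?T"
    then show "is_submod R M S" using is_submod_smult_image[OF L(1)] by auto
  next
    fix Q assume Q: "is_submod R M Q" "\<And>S. S \<in> ?T \<Longrightarrow> S \<subseteq> Q"
    have "ideal_smult L \<subseteq> Q" by (rule ideal_smult_least[OF Q(1)]) (use Q(2) in blast)
    then show "Q = carrier M" using is_submod_subset[OF Q(1)] L(2) by auto
  next
    fix S Q assume "S \<in> ?T" and Q: "is_submod R M Q" "?K \<subseteq> Q"
    then obtain y where y: "y \<in> carrier M" and S: "S = (\<lambda>l. l \<odot>\<^bsub>M\<^esub> y) ` L" by auto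
    \<comment> \<open>The \<open>l\<close> in \<open>L\<close> with \<open>l y\<close> in
      \<open>Q\<close> form a left ideal between \<open>L'\<close> and \<open>L\<close>; its two
      possible values are the two alternatives.\<close>
    let ?I = "{r \<in> carrier R. r \<odot>\<^bsub>M\<^esub> y \<in> Q} \<inter> L"
    have "left_ideal R ?I"
      using left_ideal_colon[OF Q(1) y] L(1) by (auto simp: left_ideal_def)
    moreover have "L' \<subseteq> ?I"
      using ideal_smult_mem[of _ L' y] y Q(2) L' by (auto simp: left_ideal_def)
    ultimately have "?I = L' \<or> ?I = L" using max by blast
    then show "S \<subseteq> Q \<or> S \<inter> Q \<subseteq> ?K"
    proof
      assume I: "?I = L'"
      have "l \<odot>\<^bsub>M\<^esub> y \<in> ?K" if "l \<in> L" "l \<odot>\<^bsub>M\<^esub> y \<in> Q" for l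
        using that L(1) I y by (intro ideal_smult_mem) (auto simp: left_ideal_def)
      then show ?thesis unfolding S by blast
    qed (use S in auto)
  qed
  then show ?thesis by blast
qed

end

section \<open>Left ideals as submodules, and the minimum condition\<close>

text \<open>Left ideals are the submodules of the ring over itself, so the results of
  \<open>lmod\<close> on sums, generation and avoiding an element carry over to them.\<close>

definition regular_module :: "'a ring \<Rightarrow> ('a, 'a) module" where
  "regular_module R = \<lparr>carrier = carrier R, monoid.mult = monoid.mult R, one = one R,
     zero = zero R, add = add R, smult = monoid.mult R\<rparr>"

lemma regular_module_sel [simp]:
  "carrier (regular_module R) = carrier R" "\<zero>\<^bsub>regular_module R\<^esub> = \<zero>\<^bsub>R\<^esub>"
  "x \<oplus>\<^bsub>regular_module R\<^esub> y = x \<oplus>\<^bsub>R\<^esub> y" "x \<odot>\<^bsub>regular_module R\<^esub> y = x \<otimes>\<^bsub>R\<^esub> y"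
  by (auto simp: regular_module_def)

lemma a_inv_regular_module [simp]: "\<ominus>\<^bsub>regular_module R\<^esub> x = \<ominus>\<^bsub>R\<^esub> x"
  by (simp add: regular_module_def a_inv_def m_inv_def)

lemma is_submod_regular_module: "is_submod R (regular_module R) = left_ideal R"
  by (auto simp: fun_eq_iff is_submod_def left_ideal_def)

lemma lmod_regular_module:
  assumes "ring R" shows "lmod R (regular_module R)"
proof -
  interpret ring R by fact
  have "abelian_group (regular_module R)"
    by (rule abelian_groupI) (auto simp: a_ac intro!: bexI[of _ "\<ominus>\<^bsub>R\<^esub> _"] l_neg)
  then show ?thesis
    by unfold_locales (auto simp: lmodule_def l_distr r_distr m_assoc assms)
qed

text \<open>Two predicates, because the chain condition is known for a whole class \<open>P\<close>
  while the minimum is sought in a subclass \<open>Q\<close>. Without a minimum, dependent choice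
  builds a strictly descending chain.\<close>

lemma exists_minimal_of_dcc:
  assumes dcc: "\<And>I :: nat \<Rightarrow> 'b set. (\<And>n. P (I n)) \<Longrightarrow> (\<And>n. I (Suc n) \<subseteq> I n) \<Longrightarrow> \<exists>n. \<forall>m\<ge>n. I m = I n"
    and Q: "Q X" "\<And>X. Q X \<Longrightarrow> P X"
  shows "\<exists>X. Q X \<and> (\<forall>Y. Q Y \<and> Y \<subseteq> X \<longrightarrow> Y = X)"
proof (rule ccontr)
  assume "\<not> ?thesis"
  then have "\<And>X. Q X \<Longrightarrow> \<exists>Y. Q Y \<and> Y \<subset> X" by blast
  then have "\<exists>I. \<forall>n. Q (I n) \<and> I (Suc n) \<subset> I n"
    by (intro dependent_nat_choice) (use Q(1) in auto)
  then obtain I where I: "\<And>n. Q (I n)" "\<And>n. I (Suc n) \<subset> I n" by metis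
  then obtain n where "I (Suc n) = I n" using dcc[of I] Q(2) by (metis le_SucI order_refl psubsetE)
  then show False using I(2)[of n] by simp
qed

lemma left_artinian_minimal:
  assumes "left_artinian R" "Q X" "\<And>X. Q X \<Longrightarrow> left_ideal R X"
  obtains L where "Q L" "\<And>Y. Q Y \<Longrightarrow> Y \<subseteq> L \<Longrightarrow> Y = L"
proof -
  have "\<exists>X. Q X \<and> (\<forall>Y. Q Y \<and> Y \<subseteq> X \<longrightarrow> Y = X)"
    by (rule exists_minimal_of_dcc[where P = "left_ideal R"])
      (use assms in \<open>auto simp: left_artinian_def\<close>)
  then show ?thesis using that by blast
qed

section \<open>Existence of maximal submodules over a left artinian ring\<close>

context lmod
begin

text \<open>Let \<open>L\<close> be a minimal left ideal with \<open>L M = M\<close>; then \<open>L L = L\<close>. Among the left ideals not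
  annihilated by \<open>L\<close> a minimal one \<open>L0\<close> has the form \<open>L x\<close> with \<open>x \<in> L0\<close>. If \<open>P\<close> is a left ideal
  maximal among those avoiding \<open>x\<close>, then \<open>L' = {l \<in> L. l x \<in> P}\<close> is a maximal left subideal of \<open>L\<close>.
  Hence \<open>L' M \<noteq> M\<close>, and each \<open>L y\<close> is zero or simple modulo \<open>L' M\<close>.\<close>

lemma exists_maximal_submod:
  assumes artinian: "left_artinian R" and nz: "carrier M \<noteq> {\<zero>\<^bsub>M\<^esub>}"
  shows "\<exists>P. maximal_submod R M P"
proof -
  interpret reg: lmod R "regular_module R" by (rule lmod_regular_module) (rule R.ring_axioms)
  obtain L where L: "left_ideal R L" "ideal_smult L = carrier M"
    and Lmin: "\<And>I. left_ideal R I \<Longrightarrow> ideal_smult I = carrier M \<Longrightarrow> I \<subseteq> L \<Longrightarrow> I = L"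
    by (rule left_artinian_minimal[OF artinian, of "\<lambda>L. left_ideal R L \<and> ideal_smult L = carrier M" "carrier R"])
      (use left_ideal_carrier ideal_smult_carrier in auto)
  note LD = L(1)[unfolded left_ideal_def]
  have LR: "\<And>l. l \<in> L \<Longrightarrow> l \<in> carrier R" using LD by auto
  let ?S = "{a \<otimes>\<^bsub>R\<^esub> b | a b. a \<in> L \<and> b \<in> L}"
  let ?LL = "gen_submod R (regular_module R) ?S"
  have SR: "?S \<subseteq> carrier R" using LR by auto
  have LL: "left_ideal R ?LL"
    using reg.is_submod_gen[of ?S] SR by (simp add: is_submod_regular_module)
  have LLsub: "?LL \<subseteq> L"
    by (rule reg.gen_submod_least) (use L LD LR in \<open>auto simp: is_submod_regular_module\<close>)
  have "ideal_smult ?LL = carrier M"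
  proof
    have sub: "is_submod R M (ideal_smult ?LL)"
      by (rule is_submod_ideal_smult) (use LL in \<open>simp add: left_ideal_def\<close>)
    then show "ideal_smult ?LL \<subseteq> carrier M" by (rule is_submod_subset)
    \<comment> \<open>The factor \<open>r\<close> makes \<open>?Z\<close> closed under scalars,
      which \<open>L\<close> alone would not do, being only a left ideal. Taking \<open>r\<close> to
      be the unit afterwards gives \<open>L (L M)\<close> inside \<open>(L L) M\<close>.\<close>
    let ?Z = "{z \<in> carrier M. \<forall>r\<in>carrier R. \<forall>a\<in>L. (a \<otimes>\<^bsub>R\<^esub> r) \<odot>\<^bsub>M\<^esub> z \<in> ideal_smult ?LL}"
    have "is_submod R M ?Z"
    proof (rule is_submodI)
      show "\<zero>\<^bsub>M\<^esub> \<in> ?Z" using is_submod_zero_mem[OF sub] LR by auto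
      show "x \<oplus>\<^bsub>M\<^esub> y \<in> ?Z" if "x \<in> ?Z" "y \<in> ?Z" for x y
        using that is_submod_add[OF sub] LR by (auto simp: smult_r_distr)
      show "s \<odot>\<^bsub>M\<^esub> x \<in> ?Z" if "s \<in> carrier R" "x \<in> ?Z" for s x
        using that LR by (auto simp: smult_assoc [symmetric] R.m_assoc)
    qed auto
    moreover have "l \<odot>\<^bsub>M\<^esub> y \<in> ?Z" if "l \<in> L" "y \<in> carrier M" for l y
    proof -
      have "(a \<otimes>\<^bsub>R\<^esub> r) \<odot>\<^bsub>M\<^esub> (l \<odot>\<^bsub>M\<^esub> y) \<in> ideal_smult ?LL" if "r \<in> carrier R" "a \<in> L" for r a
      proof -
        have eq: "(a \<otimes>\<^bsub>R\<^esub> r) \<odot>\<^bsub>M\<^esub> (l \<odot>\<^bsub>M\<^esub> y) = (a \<otimes>\<^bsub>R\<^esub> (r \<otimes>\<^bsub>R\<^esub> l)) \<odot>\<^bsub>M\<^esub> y"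
          using that \<open>l \<in> L\<close> \<open>y \<in> carrier M\<close> LR by (simp add: smult_assoc)
        have "a \<otimes>\<^bsub>R\<^esub> (r \<otimes>\<^bsub>R\<^esub> l) \<in> ?LL"
          using that \<open>l \<in> L\<close> LD by (intro subsetD[OF reg.gen_submod_superset] CollectI exI[of _ a] exI[of _ "r \<otimes>\<^bsub>R\<^esub> l"]) auto
        then show ?thesis unfolding eq using \<open>y \<in> carrier M\<close> by (rule ideal_smult_mem)
      qed
      then show ?thesis using that LR by auto
    qed
    ultimately have "ideal_smult L \<subseteq> ?Z" by (rule ideal_smult_least)
    then have "carrier M \<subseteq> ?Z" unfolding L(2) .
    then have "a \<odot>\<^bsub>M\<^esub> z \<in> ideal_smult ?LL" if "a \<in> L" "z \<in> carrier M" for a z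
      using that LR by (force dest: bspec[of _ _ "\<one>\<^bsub>R\<^esub>"])
    then have "ideal_smult L \<subseteq> ideal_smult ?LL" by (intro ideal_smult_least[OF sub])
    then show "carrier M \<subseteq> ideal_smult ?LL" unfolding L(2) .
  qed
  then have LLeq: "?LL = L" using Lmin[OF LL] LLsub by blast

  have "\<not> L \<subseteq> {\<zero>\<^bsub>R\<^esub>}"
  proof
    assume "L \<subseteq> {\<zero>\<^bsub>R\<^esub>}"
    then have "ideal_smult L \<subseteq> {\<zero>\<^bsub>M\<^esub>}" by (intro ideal_smult_least[OF is_submod_zero]) auto
    then show False using nz L(2) by auto
  qed
  then have "\<not> ?S \<subseteq> {\<zero>\<^bsub>R\<^esub>}"
    using reg.gen_submod_least[of "{\<zero>\<^bsub>R\<^esub>}" ?S] reg.is_submod_zero LLeq by auto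
  then have ex: "\<exists>a\<in>L. \<exists>b\<in>L. a \<otimes>\<^bsub>R\<^esub> b \<noteq> \<zero>\<^bsub>R\<^esub>" by auto
  obtain L0 where L0: "left_ideal R L0 \<and> (\<exists>a\<in>L. \<exists>b\<in>L0. a \<otimes>\<^bsub>R\<^esub> b \<noteq> \<zero>\<^bsub>R\<^esub>)"
    and L0min: "\<And>I. left_ideal R I \<and> (\<exists>a\<in>L. \<exists>b\<in>I. a \<otimes>\<^bsub>R\<^esub> b \<noteq> \<zero>\<^bsub>R\<^esub>) \<Longrightarrow> I \<subseteq> L0 \<Longrightarrow> I = L0"
    by (rule left_artinian_minimal[OF artinian,
          of "\<lambda>I. left_ideal R I \<and> (\<exists>a\<in>L. \<exists>b\<in>I. a \<otimes>\<^bsub>R\<^esub> b \<noteq> \<zero>\<^bsub>R\<^esub>)" L])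
      (use L(1) ex in auto)
  then obtain x where x: "x \<in> L0" and Lx: "\<exists>a\<in>L. a \<otimes>\<^bsub>R\<^esub> x \<noteq> \<zero>\<^bsub>R\<^esub>" by auto
  have xR: "x \<in> carrier R" using x L0 by (auto simp: left_ideal_def)
  let ?Lx = "(\<lambda>l. l \<otimes>\<^bsub>R\<^esub> x) ` L"
  have Lx_ideal: "left_ideal R ?Lx"
    using reg.is_submod_smult_image[OF L(1), of x] xR by (simp add: is_submod_regular_module)
  \<comment> \<open>Otherwise \<open>L L\<close> annihilates \<open>x\<close>, and so does
    \<open>L = L L\<close>, against the choice of \<open>x\<close>.\<close>
  have "\<exists>a\<in>L. \<exists>b\<in>?Lx. a \<otimes>\<^bsub>R\<^esub> b \<noteq> \<zero>\<^bsub>R\<^esub>"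
  proof (rule ccontr)
    assume "\<not> ?thesis"
    then have "?S \<subseteq> {r \<in> carrier R. r \<otimes>\<^bsub>R\<^esub> x \<in> {\<zero>\<^bsub>R\<^esub>}}"
      using LR xR by (auto simp: R.m_assoc)
    moreover have "is_submod R (regular_module R) {r \<in> carrier R. r \<otimes>\<^bsub>R\<^esub> x \<in> {\<zero>\<^bsub>R\<^esub>}}"
      using reg.left_ideal_colon[OF reg.is_submod_zero, of x] xR
      by (simp add: is_submod_regular_module)
    ultimately have "?LL \<subseteq> {r \<in> carrier R. r \<otimes>\<^bsub>R\<^esub> x \<in> {\<zero>\<^bsub>R\<^esub>}}"
      by (intro reg.gen_submod_least)
    then show False using Lx LLeq by auto
  qed
  moreover have "?Lx \<subseteq> L0" using L0 x LR by (auto simp: left_ideal_def)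
  ultimately have "?Lx = L0" using L0min Lx_ideal by blast
  \<comment> \<open>As \<open>x\<close> lies in \<open>L0 = L x\<close>, some \<open>e\<close> in
    \<open>L\<close> fixes \<open>x\<close>. This \<open>e\<close> witnesses
    \<open>?L' \<noteq> L\<close> below, because \<open>e x = x\<close> is not in
    \<open>P\<close>.\<close>
  then obtain e where e: "e \<in> L" "x = e \<otimes>\<^bsub>R\<^esub> x" using x by auto

  have "x \<notin> {\<zero>\<^bsub>R\<^esub>}" using Lx LR by auto
  then obtain P where P: "left_ideal R P" "x \<notin> P"
    and Pmax: "\<And>Q. left_ideal R Q \<Longrightarrow> P \<subseteq> Q \<Longrightarrow> Q \<noteq> P \<Longrightarrow> x \<in> Q"
    using reg.exists_maximal_avoiding[OF reg.is_submod_zero, of x]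
    unfolding is_submod_regular_module regular_module_sel by metis
  note PD = P(1)[unfolded left_ideal_def]
  let ?L' = "{r \<in> carrier R. r \<otimes>\<^bsub>R\<^esub> x \<in> P} \<inter> L"
  have L'ideal: "left_ideal R ?L'"
    using reg.left_ideal_colon[of P x] P(1) xR L(1)
    by (auto simp: left_ideal_def is_submod_regular_module)
  show ?thesis
  proof (rule exists_maximal_submod_of_maximal_ideal[OF L L'ideal])
    show "?L' \<subseteq> L" by auto
    have "e \<notin> ?L'" using e P(2) by auto
    then show "ideal_smult ?L' \<noteq> carrier M"
      using Lmin[OF L'ideal] e(1) by blast
    fix I assume I: "left_ideal R I" "?L' \<subseteq> I" "I \<subseteq> L"
    note ID = I(1)[unfolded left_ideal_def]
    show "I = ?L' \<or> I = L"
    proof (rule disjCI)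
      assume "I \<noteq> L"
      show "I = ?L'"
      proof (rule ccontr)
        assume "I \<noteq> ?L'"
        then obtain q where q: "q \<in> I" "q \<notin> ?L'" using I(2) by blast
        have qR: "q \<in> carrier R" using q ID by auto
        have qx: "q \<otimes>\<^bsub>R\<^esub> x \<notin> P" using q I(3) qR by blast
        \<comment> \<open>Because of \<open>q\<close>, the sum \<open>P + I x\<close> is strictly
          larger than \<open>P\<close> and so contains \<open>x\<close>. This yields
          \<open>x = p + r x\<close> with \<open>r\<close> in \<open>I\<close>.\<close>
        let ?Q = "P <+>\<^bsub>regular_module R\<^esub> ((\<lambda>l. l \<otimes>\<^bsub>R\<^esub> x) ` I)"
        have sub: "is_submod R (regular_module R) P"
            "is_submod R (regular_module R) ((\<lambda>l. l \<otimes>\<^bsub>R\<^esub> x) ` I)"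
          using P(1) reg.is_submod_smult_image[OF I(1), of x] xR
          by (simp_all add: is_submod_regular_module)
        have "P \<subseteq> ?Q" "q \<otimes>\<^bsub>R\<^esub> x \<in> ?Q" "left_ideal R ?Q"
          using reg.set_add_upper1[OF sub] reg.set_add_upper2[OF sub] q reg.is_submod_set_add[OF sub]
          by (auto simp: is_submod_regular_module)
        then have "x \<in> ?Q" using Pmax[of ?Q] qx by blast
        then obtain p r where pr: "p \<in> P" "r \<in> I" "x = p \<oplus>\<^bsub>R\<^esub> r \<otimes>\<^bsub>R\<^esub> x"
          by (auto simp: set_add_def')
        have rR: "r \<in> carrier R" "p \<in> carrier R" using pr PD ID by auto
        \<comment> \<open>Since \<open>(l - l r) x = l p\<close> is in \<open>P\<close>, the element
          \<open>l - l r\<close> is in \<open>?L'\<close> and hence in \<open>I\<close>; adding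
          \<open>l r\<close> recovers \<open>l\<close>.\<close>
        have "l \<in> I" if l: "l \<in> L" for l
        proof -
          have lR: "l \<in> carrier R" using l LR by auto
          have "(l \<ominus>\<^bsub>R\<^esub> l \<otimes>\<^bsub>R\<^esub> r) \<otimes>\<^bsub>R\<^esub> x = l \<otimes>\<^bsub>R\<^esub> x \<ominus>\<^bsub>R\<^esub> l \<otimes>\<^bsub>R\<^esub> (r \<otimes>\<^bsub>R\<^esub> x)"
            using lR rR xR by (simp add: R.l_distr R.l_minus R.m_assoc a_minus_def)
          also have "l \<otimes>\<^bsub>R\<^esub> x = l \<otimes>\<^bsub>R\<^esub> p \<oplus>\<^bsub>R\<^esub> l \<otimes>\<^bsub>R\<^esub> (r \<otimes>\<^bsub>R\<^esub> x)"
            using lR rR xR by (subst pr(3)) (simp add: R.r_distr)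
          also have "\<dots> \<ominus>\<^bsub>R\<^esub> l \<otimes>\<^bsub>R\<^esub> (r \<otimes>\<^bsub>R\<^esub> x) = l \<otimes>\<^bsub>R\<^esub> p"
            using lR rR xR by (simp add: a_minus_def R.a_assoc R.r_neg)
          also have "\<dots> \<in> P" using lR pr PD by auto
          finally have "(l \<ominus>\<^bsub>R\<^esub> l \<otimes>\<^bsub>R\<^esub> r) \<otimes>\<^bsub>R\<^esub> x \<in> P" .
          moreover have lr: "l \<otimes>\<^bsub>R\<^esub> r \<in> I" using ID lR pr by auto
          moreover have "l \<ominus>\<^bsub>R\<^esub> l \<otimes>\<^bsub>R\<^esub> r \<in> L"
            using LD l lr I(3) by (auto simp: a_minus_def)
          ultimately have "l \<ominus>\<^bsub>R\<^esub> l \<otimes>\<^bsub>R\<^esub> r \<in> I" using I(2) LR by blast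
          then have "(l \<ominus>\<^bsub>R\<^esub> l \<otimes>\<^bsub>R\<^esub> r) \<oplus>\<^bsub>R\<^esub> l \<otimes>\<^bsub>R\<^esub> r \<in> I" using lr ID by blast
          then show ?thesis using lR rR by (simp add: a_minus_def R.a_assoc R.l_neg)
        qed
        then show False using \<open>I \<noteq> L\<close> I(3) by blast
      qed
    qed
  qed
qed

section \<open>The descending chain condition for finitely generated modules\<close>

text \<open>Phrased inside the ambient \<open>M\<close>, so that an induction on generators can
  enlarge \<open>N\<close> without changing the module.\<close>

definition dcc_on :: "'u set \<Rightarrow> bool" where
  "dcc_on N \<longleftrightarrow> (\<forall>I. (\<forall>n. is_submod R M (I n) \<and> I n \<subseteq> N \<and> I (Suc n) \<subseteq> I n) \<longrightarrow>
     (\<exists>n::nat. \<forall>m\<ge>n. I m = I n))"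

lemma dcc_on_subset: "dcc_on N \<Longrightarrow> N' \<subseteq> N \<Longrightarrow> dcc_on N'"
  unfolding dcc_on_def by (meson order_trans)

lemma dcc_on_zero: "dcc_on {\<zero>\<^bsub>M\<^esub>}"
  unfolding dcc_on_def
proof (intro allI impI)
  fix I :: "nat \<Rightarrow> 'u set"
  assume I: "\<forall>n. is_submod R M (I n) \<and> I n \<subseteq> {\<zero>\<^bsub>M\<^esub>} \<and> I (Suc n) \<subseteq> I n"
  then have "I n = {\<zero>\<^bsub>M\<^esub>}" for n using is_submod_zero_mem[of R M "I n"] by auto
  then show "\<exists>n. \<forall>m\<ge>n. I m = I n" by simp
qed

text \<open>Modulo \<open>N\<close>, the module \<open>N + R x\<close> is a quotient of
  \<open>R\<close>. Along a chain \<open>I n\<close>, the trace \<open>A n\<close> on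
  \<open>N\<close> and the left ideal \<open>B n\<close> of coefficients of \<open>x\<close> modulo
  \<open>N\<close> both become constant, and from then on so does \<open>I n\<close>.\<close>

lemma dcc_on_add_cyclic:
  assumes artinian: "left_artinian R" and N: "is_submod R M N" "dcc_on N" and x: "x \<in> carrier M"
  shows "dcc_on (N <+>\<^bsub>M\<^esub> (\<lambda>r. r \<odot>\<^bsub>M\<^esub> x) ` carrier R)"
  unfolding dcc_on_def
proof (intro allI impI)
  fix I :: "nat \<Rightarrow> 'u set"
  let ?N' = "N <+>\<^bsub>M\<^esub> (\<lambda>r. r \<odot>\<^bsub>M\<^esub> x) ` carrier R"
  assume "\<forall>n. is_submod R M (I n) \<and> I n \<subseteq> ?N' \<and> I (Suc n) \<subseteq> I n"
  then have I: "\<And>n. is_submod R M (I n)" "\<And>n. I n \<subseteq> ?N'" "\<And>n. I (Suc n) \<subseteq> I n" by auto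
  have anti: "I m \<subseteq> I n" if "n \<le> m" for m n
    using that I(3) by (rule lift_Suc_antimono_le[rotated])
  define A where "A n = I n \<inter> N" for n
  define B where "B n = {r \<in> carrier R. r \<odot>\<^bsub>M\<^esub> x \<in> N <+>\<^bsub>M\<^esub> I n}" for n
  have "\<forall>n. is_submod R M (A n) \<and> A n \<subseteq> N \<and> A (Suc n) \<subseteq> A n"
    unfolding A_def using I(1) N(1) subsetD[OF I(3)] by (auto intro: is_submod_Int)
  then obtain n0 where n0: "\<And>m. m \<ge> n0 \<Longrightarrow> A m = A n0"
    using N(2) unfolding dcc_on_def by blast
  have "\<forall>n. left_ideal R (B n) \<and> B (Suc n) \<subseteq> B n"
  proof (intro allI conjI)
    fix n
    show "left_ideal R (B n)"
      unfolding B_def using x N(1) I(1) by (intro left_ideal_colon is_submod_set_add)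
    show "B (Suc n) \<subseteq> B n" unfolding B_def set_add_def' using I(3)[of n] by blast
  qed
  then obtain n1 where n1: "\<And>m. m \<ge> n1 \<Longrightarrow> B m = B n1"
    using artinian unfolding left_artinian_def by blast
  define n where "n = max n0 n1"
  have "I m = I n" if m: "m \<ge> n" for m
  proof
    show "I m \<subseteq> I n" using anti m by simp
    have Aeq: "A m = A n" and Beq: "B m = B n"
      using n0[of m] n0[of n] n1[of m] n1[of n] m by (auto simp: n_def)
    note c = is_submod_carrierD[OF N(1)] is_submod_carrierD[OF I(1)]
    show "I n \<subseteq> I m"
    proof
      fix y assume y: "y \<in> I n"
      then obtain u r where u: "u \<in> N" and r: "r \<in> carrier R" and y_eq: "y = u \<oplus>\<^bsub>M\<^esub> r \<odot>\<^bsub>M\<^esub> x"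
        using I(2)[of n] by (auto simp: set_add_def')
      have "r \<odot>\<^bsub>M\<^esub> x = \<ominus>\<^bsub>M\<^esub> u \<oplus>\<^bsub>M\<^esub> y"
        using c(1)[OF u] r x by (simp add: y_eq r_neg1)
      then have "r \<in> B n"
        using r y is_submod_neg[OF N(1) u] unfolding B_def set_add_def' by blast
      then have "r \<in> B m" using Beq by simp
      then obtain u' y' where u': "u' \<in> N" and y': "y' \<in> I m" and rx: "r \<odot>\<^bsub>M\<^esub> x = u' \<oplus>\<^bsub>M\<^esub> y'"
        by (auto simp: B_def set_add_def')
      have yI: "y' \<in> I n" using y' anti[OF m] by auto
      \<comment> \<open>Equality of the ideals \<open>B\<close> has replaced \<open>r x\<close> by
        an expression with \<open>y'\<close> in the smaller \<open>I m\<close>. The difference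
        \<open>u + u'\<close> of \<open>y\<close> and \<open>y'\<close> lies in \<open>N\<close> and
        in \<open>I n\<close>, so equality of the traces moves it into \<open>I m\<close>.\<close>
      have eq: "y = y' \<oplus>\<^bsub>M\<^esub> (u \<oplus>\<^bsub>M\<^esub> u')"
        using c(1)[OF u] c(1)[OF u'] c(2)[OF y'] by (simp add: y_eq rx a_ac)
      have uu: "u \<oplus>\<^bsub>M\<^esub> u' \<in> N" using is_submod_add[OF N(1) u u'] .
      then have "u \<oplus>\<^bsub>M\<^esub> u' \<in> I n"
        using is_submod_add_cancel[OF I(1) yI] y c(1) eq by auto
      then have "u \<oplus>\<^bsub>M\<^esub> u' \<in> A n" using uu by (simp add: A_def)
      then have "u \<oplus>\<^bsub>M\<^esub> u' \<in> I m" using Aeq by (auto simp: A_def)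
      then show "y \<in> I m" unfolding eq using is_submod_add[OF I(1) y'] by blast
    qed
  qed
  then show "\<exists>n. \<forall>m\<ge>n. I m = I n" by blast
qed

lemma dcc_on_gen:
  assumes artinian: "left_artinian R"
  shows "finite S \<Longrightarrow> S \<subseteq> carrier M \<Longrightarrow> dcc_on (gen_submod R M S)"
proof (induction S rule: finite_induct)
  case empty
  show ?case
    by (rule dcc_on_subset[OF dcc_on_zero]) (rule gen_submod_least[OF is_submod_zero], simp)
next
  case (insert x S)
  have gS: "is_submod R M (gen_submod R M S)" using insert by (intro is_submod_gen) auto
  have x: "x \<in> carrier M" using insert by auto
  let ?Rx = "(\<lambda>r. r \<odot>\<^bsub>M\<^esub> x) ` carrier R"
  have Rx: "is_submod R M ?Rx"
    by (rule is_submod_smult_image[OF left_ideal_carrier x])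
  have "x = \<one>\<^bsub>R\<^esub> \<odot>\<^bsub>M\<^esub> x" using x by simp
  then have "x \<in> ?Rx" by blast
  then have "insert x S \<subseteq> gen_submod R M S <+>\<^bsub>M\<^esub> ?Rx"
    using gen_submod_superset set_add_upper1[OF gS Rx] set_add_upper2[OF gS Rx] by blast
  then have "gen_submod R M (insert x S) \<subseteq> gen_submod R M S <+>\<^bsub>M\<^esub> ?Rx"
    by (intro gen_submod_least is_submod_set_add gS Rx)
  moreover have "dcc_on (gen_submod R M S <+>\<^bsub>M\<^esub> ?Rx)"
    using insert x gS by (intro dcc_on_add_cyclic artinian) auto
  ultimately show ?case by (rule dcc_on_subset[rotated])
qed

end

section \<open>Submodules as modules, and their finite generation\<close>

lemma submod_sel [simp]:
  "carrier (submod M N) = N" "\<zero>\<^bsub>submod M N\<^esub> = \<zero>\<^bsub>M\<^esub>"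
  "x \<oplus>\<^bsub>submod M N\<^esub> y = x \<oplus>\<^bsub>M\<^esub> y" "r \<odot>\<^bsub>submod M N\<^esub> y = r \<odot>\<^bsub>M\<^esub> y"
  by (auto simp: submod_def)

lemma submod_submod [simp]: "submod (submod M A) B = submod M B"
  by (simp add: submod_def)

lemma submod_carrier [simp]: "submod M (carrier M) = M"
  by (simp add: submod_def)

context lmod
begin

lemma lmod_submod:
  assumes N: "is_submod R M N" shows "lmod R (submod M N)"
proof -
  note c = is_submod_carrierD[OF N]
  have "abelian_group (submod M N)"
  proof (rule abelian_groupI)
    show "\<exists>y\<in>carrier (submod M N). y \<oplus>\<^bsub>submod M N\<^esub> x = \<zero>\<^bsub>submod M N\<^esub>"
      if "x \<in> carrier (submod M N)" for x
      using that c is_submod_neg[OF N] by (auto intro!: bexI[of _ "\<ominus>\<^bsub>M\<^esub> x"] l_neg)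
  qed (use c N in \<open>auto simp: a_ac is_submod_zero_mem is_submod_add\<close>)
  then show ?thesis
    using c by unfold_locales
      (auto simp: lmodule_def R.ring_axioms smult_l_distr smult_r_distr smult_assoc is_submod_smult[OF N])
qed

text \<open>The inverse is a definite description over the carrier, so shrinking the carrier could
  change it. Multiplication by \<open>-1\<close> does not mention the carrier and links the
  two.\<close>

lemma a_inv_submod:
  assumes N: "is_submod R M N" and x: "x \<in> N"
  shows "\<ominus>\<^bsub>submod M N\<^esub> x = \<ominus>\<^bsub>M\<^esub> x"
proof -
  interpret S: lmod R "submod M N" by (rule lmod_submod[OF N])
  show ?thesis
    using S.smult_minus_one[of x] smult_minus_one[of x] x is_submod_carrierD[OF N x] by simp
qed

lemma is_submod_submod:
  assumes N: "is_submod R M N"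
  shows "is_submod R (submod M N) K \<longleftrightarrow> is_submod R M K \<and> K \<subseteq> N"
proof (cases "K \<subseteq> N")
  case True
  then have "\<And>x. x \<in> K \<Longrightarrow> \<ominus>\<^bsub>submod M N\<^esub> x = \<ominus>\<^bsub>M\<^esub> x" using a_inv_submod[OF N] by auto
  moreover have "K \<subseteq> carrier M" using True is_submod_subset[OF N] by auto
  ultimately show ?thesis using True by (auto simp: is_submod_def)
qed (auto simp: is_submod_def)

lemma gen_submod_submod:
  assumes N: "is_submod R M N" and S: "S \<subseteq> N"
  shows "gen_submod R (submod M N) S = gen_submod R M S"
proof
  interpret S: lmod R "submod M N" by (rule lmod_submod[OF N])
  have S': "S \<subseteq> carrier M" using S is_submod_subset[OF N] by auto
  show "gen_submod R (submod M N) S \<subseteq> gen_submod R M S"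
    using is_submod_gen[OF S'] gen_submod_least[OF N S]
    by (intro S.gen_submod_least gen_submod_superset) (simp add: is_submod_submod[OF N])
  show "gen_submod R M S \<subseteq> gen_submod R (submod M N) S"
    using S.is_submod_gen[of S] S
    by (intro gen_submod_least S.gen_submod_superset) (simp add: is_submod_submod[OF N])
qed

lemma fg_submod_iff:
  assumes N: "is_submod R M N"
  shows "fg_mod R (submod M N) \<longleftrightarrow> (\<exists>S. finite S \<and> S \<subseteq> N \<and> gen_submod R M S = N)"
  using lmod.lmodule[OF lmod_submod[OF N]] gen_submod_submod[OF N] by (auto simp: fg_mod_def)

end

lemma fg_modD: "fg_mod R M \<Longrightarrow> lmod R M"
  by (auto simp: fg_mod_def lmod_def)

text \<open>A submodule minimal among those that are not finitely generated would have a maximal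
  submodule, and would be generated by the latter and one more element.\<close>

lemma fg_submod:
  assumes artinian: "left_artinian R" and fg: "fg_mod R M" and N: "is_submod R M N"
  shows "fg_mod R (submod M N)"
proof (rule ccontr)
  assume notfg: "\<not> fg_mod R (submod M N)"
  interpret lmod R M by (rule fg_modD[OF fg])
  have dcc: "dcc_on (carrier M)"
    using fg dcc_on_gen[OF artinian] unfolding fg_mod_def by metis
  have "\<exists>X. (is_submod R M X \<and> \<not> fg_mod R (submod M X)) \<and>
      (\<forall>Y. (is_submod R M Y \<and> \<not> fg_mod R (submod M Y)) \<and> Y \<subseteq> X \<longrightarrow> Y = X)"
  proof (rule exists_minimal_of_dcc[where P = "is_submod R M"])
    show "\<exists>n. \<forall>m\<ge>n. I m = I n"
      if "\<And>n. is_submod R M (I n)" "\<And>n. I (Suc n) \<subseteq> I n" for I :: "nat \<Rightarrow> 'b set"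
      using dcc that is_submod_subset[OF that(1)] unfolding dcc_on_def by simp
  qed (use N notfg in auto)
  then obtain X where X: "is_submod R M X" "\<not> fg_mod R (submod M X)"
    and Xmin: "\<And>Y. is_submod R M Y \<Longrightarrow> Y \<subseteq> X \<Longrightarrow> Y \<noteq> X \<Longrightarrow> fg_mod R (submod M Y)"
    by auto
  interpret X: lmod R "submod M X" by (rule lmod_submod[OF X(1)])
  \<comment> \<open>The zero submodule is generated by the empty set, so \<open>X\<close> is nonzero
    and a maximal submodule exists in it.\<close>
  have "gen_submod R M {} = {\<zero>\<^bsub>M\<^esub>}"
    using gen_submod_least[OF is_submod_zero, of "{}"] is_submod_zero_mem[OF is_submod_gen[of "{}"]]
    by auto
  then have "X \<noteq> {\<zero>\<^bsub>M\<^esub>}" using X(2) unfolding fg_submod_iff[OF X(1)] by auto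
  then obtain P where P: "maximal_submod R (submod M X) P"
    using X.exists_maximal_submod[OF artinian] by auto
  then have Psub: "is_submod R M P" "P \<subseteq> X" "P \<noteq> X"
    by (auto simp: maximal_submod_def is_submod_submod[OF X(1)])
  then obtain S where S: "finite S" "S \<subseteq> P" "gen_submod R M S = P"
    using Xmin[OF Psub] fg_submod_iff[OF Psub(1)] by auto
  obtain x where x: "x \<in> X" "x \<notin> P" using Psub by auto
  let ?G = "gen_submod R M (insert x S)"
  have sub: "insert x S \<subseteq> X" using S Psub x by auto
  then have "insert x S \<subseteq> carrier M" using is_submod_subset[OF X(1)] by (rule subset_trans)
  then have G: "is_submod R M ?G" by (rule is_submod_gen)
  have "?G \<subseteq> X" using X(1) sub by (rule gen_submod_least)
  have "insert x S \<subseteq> ?G" by (rule gen_submod_superset)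
  then have "P \<subseteq> ?G" "x \<in> ?G" using gen_submod_least[OF G, of S] S by auto
  then have "?G = X"
    using P G \<open>?G \<subseteq> X\<close> x by (auto simp: maximal_submod_def is_submod_submod[OF X(1)])
  then show False using X(2) S(1) sub unfolding fg_submod_iff[OF X(1)] by blast
qed

section \<open>Homomorphisms and quotient modules\<close>

lemma
  assumes "mod_hom R M N f"
  shows mod_hom_closed: "x \<in> carrier M \<Longrightarrow> f x \<in> carrier N"
    and mod_hom_add: "x \<in> carrier M \<Longrightarrow> y \<in> carrier M \<Longrightarrow> f (x \<oplus>\<^bsub>M\<^esub> y) = f x \<oplus>\<^bsub>N\<^esub> f y"
    and mod_hom_smult: "r \<in> carrier R \<Longrightarrow> x \<in> carrier M \<Longrightarrow> f (r \<odot>\<^bsub>M\<^esub> x) = r \<odot>\<^bsub>N\<^esub> f x"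
  using assms by (auto simp: mod_hom_def)

lemma mod_hom_comp:
  "mod_hom R L M f \<Longrightarrow> mod_hom R M N g \<Longrightarrow> mod_hom R L N (g \<circ> f)"
  by (auto simp: mod_hom_def Pi_iff)

lemma mod_hom_submod:
  assumes "mod_hom R M N f" "is_submod R M A" "f ` A \<subseteq> B"
  shows "mod_hom R (submod M A) (submod N B) f"
  using assms is_submod_carrierD[OF assms(2)] by (auto simp: mod_hom_def)

locale lmod_hom = M: lmod R M + N: lmod R N for R :: "'a ring" and M N :: "('a, 'u) module" +
  fixes f :: "'u \<Rightarrow> 'u"
  assumes hom: "mod_hom R M N f"
begin

lemmas closed = mod_hom_closed[OF hom]
lemmas add = mod_hom_add[OF hom]
lemmas smult = mod_hom_smult[OF hom]

lemma zero: "f \<zero>\<^bsub>M\<^esub> = \<zero>\<^bsub>N\<^esub>"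
  using smult[of "\<zero>\<^bsub>R\<^esub>" "\<zero>\<^bsub>M\<^esub>"] closed[of "\<zero>\<^bsub>M\<^esub>"] by simp

lemma is_submod_preimage:
  assumes "is_submod R N K" shows "is_submod R M {x \<in> carrier M. f x \<in> K}"
  by (rule M.is_submodI)
    (auto simp: zero add smult is_submod_zero_mem[OF assms] is_submod_add[OF assms] is_submod_smult[OF assms])

lemma is_submod_image:
  assumes "is_submod R M K" shows "is_submod R N (f ` K)"
proof (rule N.is_submodI)
  note c = is_submod_carrierD[OF assms]
  show "f ` K \<subseteq> carrier N" using c closed by auto
  show "\<zero>\<^bsub>N\<^esub> \<in> f ` K" using zero is_submod_zero_mem[OF assms] by (metis imageI)
  show "u \<oplus>\<^bsub>N\<^esub> v \<in> f ` K" if "u \<in> f ` K" "v \<in> f ` K" for u v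
    using that c is_submod_add[OF assms] by (auto simp: add[symmetric])
  show "r \<odot>\<^bsub>N\<^esub> u \<in> f ` K" if "r \<in> carrier R" "u \<in> f ` K" for r u
    using that c is_submod_smult[OF assms] by (auto simp: smult[symmetric])
qed

lemma fg_surj:
  assumes "fg_mod R M" "f ` carrier M = carrier N"
  shows "fg_mod R N"
proof -
  obtain S where S: "finite S" "S \<subseteq> carrier M" "gen_submod R M S = carrier M"
    using assms(1) by (auto simp: fg_mod_def)
  have "f ` S \<subseteq> carrier N" using S closed by auto
  then have K: "is_submod R N (gen_submod R N (f ` S))" (is "is_submod R N ?K")
    by (rule N.is_submod_gen)
  have "f ` S \<subseteq> ?K" by (rule N.gen_submod_superset)
  then have "gen_submod R M S \<subseteq> {x \<in> carrier M. f x \<in> ?K}"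
    using S(2) by (intro M.gen_submod_least is_submod_preimage K) auto
  then have "carrier N \<subseteq> ?K" unfolding S(3) assms(2)[symmetric] by auto
  then have "?K = carrier N" using is_submod_subset[OF K] by auto
  then show ?thesis
    unfolding fg_mod_def using N.lmodule S(1) \<open>f ` S \<subseteq> carrier N\<close> by blast
qed

end

text \<open>Here \<open>N\<close> is a bare record, and its axioms are read off from those of
  \<open>M\<close> through \<open>f\<close>. The zero has to be matched by hypothesis, since
  additivity does not determine it in a bare record. For quotients this leaves only the
  compatibility of \<open>qrep\<close> to check.\<close>

lemma lmod_surj:
  assumes "lmod R M" and hom: "mod_hom R M N f" and surj: "f ` carrier M = carrier N"
    and zero: "f \<zero>\<^bsub>M\<^esub> = \<zero>\<^bsub>N\<^esub>"
  shows "lmod R N"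
proof -
  interpret M: lmod R M by fact
  note add = mod_hom_add[OF hom, symmetric] and smult = mod_hom_smult[OF hom, symmetric]
  have "abelian_group N"
  proof (rule abelian_groupI)
    show "\<exists>y\<in>carrier N. y \<oplus>\<^bsub>N\<^esub> x = \<zero>\<^bsub>N\<^esub>" if "x \<in> carrier N" for x
    proof -
      obtain u where u: "u \<in> carrier M" "x = f u" using \<open>x \<in> carrier N\<close> unfolding surj[symmetric] by auto
      have "f (\<ominus>\<^bsub>M\<^esub> u) \<oplus>\<^bsub>N\<^esub> x = \<zero>\<^bsub>N\<^esub>" using u by (simp add: add M.l_neg zero)
      moreover have "f (\<ominus>\<^bsub>M\<^esub> u) \<in> carrier N" using u by (simp add: mod_hom_closed[OF hom])
      ultimately show ?thesis by blast
    qed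
  qed (auto simp: surj[symmetric] zero[symmetric] add M.a_ac)
  then show ?thesis
    by unfold_locales
      (auto simp: lmodule_def M.R.ring_axioms surj[symmetric] add smult
        M.smult_l_distr M.smult_r_distr M.smult_assoc)
qed

context lmod
begin

lemma subgroup_of_is_submod:
  assumes "is_submod R M L" shows "subgroup L (add_monoid M)"
  by (rule subgroup.intro)
    (use is_submod_subset[OF assms] is_submod_zero_mem[OF assms] is_submod_add[OF assms]
      is_submod_neg[OF assms] in \<open>auto simp: a_inv_def\<close>)

lemma qrep_mem:
  assumes "is_submod R M L" "x \<in> carrier M"
  obtains l where "l \<in> L" "qrep M L x = l \<oplus>\<^bsub>M\<^esub> x"
proof -
  have "\<zero>\<^bsub>M\<^esub> \<oplus>\<^bsub>M\<^esub> x \<in> a_r_coset M L x"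
    unfolding a_r_coset_def' using is_submod_zero_mem[OF assms(1)] by blast
  then have "qrep M L x \<in> a_r_coset M L x" unfolding qrep_def by (rule someI)
  then show ?thesis using that by (auto simp: a_r_coset_def')
qed

lemma qrep_closed:
  assumes "is_submod R M L" "x \<in> carrier M" shows "qrep M L x \<in> carrier M"
  using qrep_mem[OF assms] is_submod_carrierD[OF assms(1)] assms(2) by (metis a_closed)

lemma qrep_eq_iff:
  assumes L: "is_submod R M L" and x: "x \<in> carrier M" and y: "y \<in> carrier M"
  shows "qrep M L x = qrep M L y \<longleftrightarrow> x \<ominus>\<^bsub>M\<^esub> y \<in> L"
proof
  note c = is_submod_carrierD[OF L]
  { assume eq: "qrep M L x = qrep M L y"
    obtain l where l: "l \<in> L" "qrep M L x = l \<oplus>\<^bsub>M\<^esub> x" by (rule qrep_mem[OF L x])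
    obtain k where k: "k \<in> L" "qrep M L y = k \<oplus>\<^bsub>M\<^esub> y" by (rule qrep_mem[OF L y])
    have "l \<oplus>\<^bsub>M\<^esub> x = k \<oplus>\<^bsub>M\<^esub> y" using eq l k by simp
    then have "l \<oplus>\<^bsub>M\<^esub> (x \<ominus>\<^bsub>M\<^esub> y) = k"
      using c[OF l(1)] c[OF k(1)] x y
      by (simp add: a_minus_def a_assoc [symmetric]) (simp add: a_assoc r_neg)
    then show "x \<ominus>\<^bsub>M\<^esub> y \<in> L" using is_submod_add_cancel[OF L l(1)] k(1) x y by auto }
  { assume "x \<ominus>\<^bsub>M\<^esub> y \<in> L"
    moreover have "x = (x \<ominus>\<^bsub>M\<^esub> y) \<oplus>\<^bsub>M\<^esub> y" using x y by (simp add: a_minus_def a_assoc l_neg)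
    ultimately have "x \<in> a_r_coset M L y" unfolding a_r_coset_def' by blast
    \<comment> \<open>The choice in \<open>qrep\<close> depends on the coset as a set, so equal
      cosets have equal representatives.\<close>
    then have "a_r_coset M L y = a_r_coset M L x"
      unfolding a_r_coset_def by (rule a_repr_independence'[OF _ y subgroup_of_is_submod[OF L]])
    then show "qrep M L x = qrep M L y" by (simp add: qrep_def) }
qed

lemma qrep_eqI:
  assumes "is_submod R M L" "x \<in> carrier M" "y \<in> carrier M" "l \<in> L" "x = l \<oplus>\<^bsub>M\<^esub> y"
  shows "qrep M L x = qrep M L y"
proof -
  have "x \<ominus>\<^bsub>M\<^esub> y = l"
    using assms is_submod_carrierD[OF assms(1,4)] by (simp add: a_minus_def a_assoc r_neg)
  then show ?thesis using assms qrep_eq_iff by simp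
qed

lemma qrep_eq_zero_iff:
  assumes "is_submod R M L" "x \<in> carrier M"
  shows "qrep M L x = \<zero>\<^bsub>quotmod M L\<^esub> \<longleftrightarrow> x \<in> L"
proof -
  have eq: "\<ominus>\<^bsub>M\<^esub> \<zero>\<^bsub>M\<^esub> = \<zero>\<^bsub>M\<^esub>" by (rule minus_equality) auto
  have "x \<ominus>\<^bsub>M\<^esub> \<zero>\<^bsub>M\<^esub> = x" unfolding a_minus_def eq using assms(2) by (rule r_zero)
  then show ?thesis
    using qrep_eq_iff[OF assms zero_closed] by (simp add: quotmod_def)
qed

text \<open>The operations of \<open>quotmod\<close> act on representatives and normalise the
  result. Passing from elements to their representatives changes sums and scalar multiples by
  members of \<open>L\<close> only.\<close>

lemma quotmod_hom:
  assumes L: "is_submod R M L"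
  shows "mod_hom R M (quotmod M L) (qrep M L)"
proof -
  note c = is_submod_carrierD[OF L]
  have "qrep M L (x \<oplus>\<^bsub>M\<^esub> y) = qrep M L (qrep M L x \<oplus>\<^bsub>M\<^esub> qrep M L y)"
    if xy: "x \<in> carrier M" "y \<in> carrier M" for x y
  proof (rule sym)
    obtain l where l: "l \<in> L" "qrep M L x = l \<oplus>\<^bsub>M\<^esub> x" by (rule qrep_mem[OF L xy(1)])
    obtain k where k: "k \<in> L" "qrep M L y = k \<oplus>\<^bsub>M\<^esub> y" by (rule qrep_mem[OF L xy(2)])
    show "qrep M L (qrep M L x \<oplus>\<^bsub>M\<^esub> qrep M L y) = qrep M L (x \<oplus>\<^bsub>M\<^esub> y)"
      using xy l k c by (intro qrep_eqI[OF L, where l = "l \<oplus>\<^bsub>M\<^esub> k"]) (auto simp: a_ac is_submod_add[OF L])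
  qed
  moreover have "qrep M L (r \<odot>\<^bsub>M\<^esub> x) = qrep M L (r \<odot>\<^bsub>M\<^esub> qrep M L x)"
    if x: "r \<in> carrier R" "x \<in> carrier M" for r x
  proof (rule sym)
    obtain l where l: "l \<in> L" "qrep M L x = l \<oplus>\<^bsub>M\<^esub> x" by (rule qrep_mem[OF L x(2)])
    show "qrep M L (r \<odot>\<^bsub>M\<^esub> qrep M L x) = qrep M L (r \<odot>\<^bsub>M\<^esub> x)"
      using x l c by (intro qrep_eqI[OF L, where l = "r \<odot>\<^bsub>M\<^esub> l"]) (auto simp: smult_r_distr is_submod_smult[OF L])
  qed
  ultimately show ?thesis by (simp add: mod_hom_def quotmod_def)
qed

lemma quotmod_surj: "qrep M L ` carrier M = carrier (quotmod M L)"
  by (simp add: quotmod_def)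

lemma lmod_quotmod:
  assumes L: "is_submod R M L" shows "lmod R (quotmod M L)"
  using lmod_axioms quotmod_hom[OF L] quotmod_surj by (rule lmod_surj) (simp add: quotmod_def)

lemma quotmod_trivial_iff:
  assumes L: "is_submod R M L"
  shows "carrier (quotmod M L) = {\<zero>\<^bsub>quotmod M L\<^esub>} \<longleftrightarrow> L = carrier M"
proof -
  have "carrier (quotmod M L) \<noteq> {}" unfolding quotmod_surj[symmetric] using zero_closed by blast
  then have "carrier (quotmod M L) = {\<zero>\<^bsub>quotmod M L\<^esub>} \<longleftrightarrow> carrier (quotmod M L) \<subseteq> {\<zero>\<^bsub>quotmod M L\<^esub>}"
    by auto
  also have "\<dots> \<longleftrightarrow> (\<forall>x\<in>carrier M. qrep M L x = \<zero>\<^bsub>quotmod M L\<^esub>)"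
    unfolding quotmod_surj[symmetric] by auto
  also have "\<dots> \<longleftrightarrow> carrier M \<subseteq> L" using qrep_eq_zero_iff[OF L] by auto
  finally show ?thesis using is_submod_subset[OF L] by auto
qed

lemma is_submod_rad: "is_submod R M (rad R M)"
  unfolding rad_def by (rule is_submod_Inter) (auto simp: is_submod_carrier maximal_submod_def)

lemma is_submod_soc: "is_submod R M (soc R M)"
  unfolding soc_def by (rule is_submod_gen) (auto simp: simple_submod_def dest: is_submod_carrierD)

end

lemma fg_quotmod:
  assumes "fg_mod R M" "is_submod R M L"
  shows "fg_mod R (quotmod M L)"
proof -
  interpret M: lmod R M by (rule fg_modD[OF assms(1)])
  interpret lmod_hom R M "quotmod M L" "qrep M L"
    by (intro lmod_hom.intro M.lmod_axioms M.lmod_quotmod lmod_hom_axioms.intro M.quotmod_hom assms)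
  show ?thesis using assms(1) M.quotmod_surj by (rule fg_surj)
qed

section \<open>Radical and socle under homomorphisms\<close>

context lmod_hom
begin

text \<open>Surjectivity of \<open>f\<close> is replaced by one element outside the preimage. If
  \<open>K\<close> is strictly above the preimage, then \<open>P + f K\<close> is all of
  \<open>N\<close>, so each \<open>a\<close> in \<open>M\<close> differs from some \<open>b\<close>
  in \<open>K\<close> by an element of the preimage, which lies in \<open>K\<close>.\<close>

lemma is_submod_maximal_preimage:
  assumes P: "maximal_submod R N P" and x: "x \<in> carrier M" "f x \<notin> P"
  shows "maximal_submod R M {x \<in> carrier M. f x \<in> P}"
proof -
  let ?P = "{x \<in> carrier M. f x \<in> P}"
  have PN: "is_submod R N P" using P by (simp add: maximal_submod_def)
  have "K = carrier M" if K: "is_submod R M K" "?P \<subseteq> K" "K \<noteq> ?P" for K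
  proof -
    note c = is_submod_carrierD[OF K(1)]
    obtain k where k: "k \<in> K" "f k \<notin> P" using K c by auto
    have fK: "is_submod R N (f ` K)" by (rule is_submod_image[OF K(1)])
    have "P \<subseteq> P <+>\<^bsub>N\<^esub> f ` K" "f k \<in> P <+>\<^bsub>N\<^esub> f ` K"
      using N.set_add_upper1[OF PN fK] N.set_add_upper2[OF PN fK] k by auto
    then have eq: "P <+>\<^bsub>N\<^esub> f ` K = carrier N"
      using P N.is_submod_set_add[OF PN fK] k(2) unfolding maximal_submod_def by metis
    have "a \<in> K" if a: "a \<in> carrier M" for a
    proof -
      have "f a \<in> P <+>\<^bsub>N\<^esub> f ` K" unfolding eq by (rule closed[OF a])
      then obtain p b where b: "p \<in> P" "b \<in> K" "f a = p \<oplus>\<^bsub>N\<^esub> f b" by (auto simp: set_add_def')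
      note bM = c[OF b(2)] and pN = is_submod_carrierD[OF PN b(1)]
      have "f (a \<ominus>\<^bsub>M\<^esub> b) \<oplus>\<^bsub>N\<^esub> f b = f a"
        using a bM by (simp add: add[symmetric] a_minus_def M.a_assoc M.l_neg)
      then have "f (a \<ominus>\<^bsub>M\<^esub> b) = p"
        using b(3) a bM pN closed by (metis M.minus_closed N.add.right_cancel)
      then have "a \<ominus>\<^bsub>M\<^esub> b \<in> K" using K(2) b(1) a bM by auto
      then have "(a \<ominus>\<^bsub>M\<^esub> b) \<oplus>\<^bsub>M\<^esub> b \<in> K" using is_submod_add[OF K(1)] b(2) by auto
      then show ?thesis using a bM by (simp add: a_minus_def M.a_assoc M.l_neg)
    qed
    then show ?thesis using c by auto
  qed
  then show ?thesis
    unfolding maximal_submod_def using is_submod_preimage[OF PN] x by blast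
qed

text \<open>If \<open>f x\<close> were nonzero, some maximal submodule of the socle would avoid it.
  Its preimage would be a maximal submodule of \<open>M\<close> without \<open>x\<close>, although
  \<open>x\<close> is in the radical.\<close>

lemma rad_to_soc:
  assumes im: "f ` carrier M \<subseteq> soc R N" and x: "x \<in> rad R M"
  shows "f x = \<zero>\<^bsub>N\<^esub>"
proof (rule ccontr)
  assume nz: "f x \<noteq> \<zero>\<^bsub>N\<^esub>"
  let ?S = "submod N (soc R N)"
  have xM: "x \<in> carrier M" using x by (auto simp: rad_def)
  interpret S: lmod R ?S by (rule N.lmod_submod[OF N.is_submod_soc])
  interpret h: lmod_hom R M ?S f
    by unfold_locales (use hom im in \<open>auto simp: mod_hom_def\<close>)
  have T_soc: "T \<subseteq> soc R N" if "simple_submod R N T" for T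
    using N.gen_submod_superset[of "\<Union>{T. simple_submod R N T}"] that by (auto simp: soc_def)
  have "\<exists>P. maximal_submod R ?S P \<and> {\<zero>\<^bsub>?S\<^esub>} \<subseteq> P \<and> f x \<notin> P"
  proof (rule S.exists_maximal_submod_avoiding[where \<T> = "{T. simple_submod R N T}"])
    show "is_submod R ?S {\<zero>\<^bsub>?S\<^esub>}" by (rule S.is_submod_zero)
    show "f x \<in> carrier ?S" using im xM by auto
    show "f x \<notin> {\<zero>\<^bsub>?S\<^esub>}" using nz by simp
    show "is_submod R ?S T" if "T \<in> {T. simple_submod R N T}" for T
      using that T_soc by (auto simp: N.is_submod_submod[OF N.is_submod_soc] simple_submod_def)
  next
    fix Q assume Q: "is_submod R ?S Q" "\<And>T. T \<in> {T. simple_submod R N T} \<Longrightarrow> T \<subseteq> Q"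
    then have "is_submod R N Q" "Q \<subseteq> soc R N"
      by (auto simp: N.is_submod_submod[OF N.is_submod_soc])
    moreover have "soc R N \<subseteq> Q"
      unfolding soc_def using \<open>is_submod R N Q\<close> Q(2) by (intro N.gen_submod_least) auto
    ultimately show "Q = carrier ?S" by auto
  next
    fix T Q assume T: "T \<in> {T. simple_submod R N T}" and Q: "is_submod R ?S Q"
    have "is_submod R N (T \<inter> Q)"
      using T Q by (intro N.is_submod_Int)
        (auto simp: simple_submod_def N.is_submod_submod[OF N.is_submod_soc])
    then have "T \<inter> Q = {\<zero>\<^bsub>N\<^esub>} \<or> T \<inter> Q = T" using T by (simp add: simple_submod_def)
    then show "T \<subseteq> Q \<or> T \<inter> Q \<subseteq> {\<zero>\<^bsub>?S\<^esub>}" by auto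
  qed
  then obtain P where P: "maximal_submod R ?S P" "f x \<notin> P" by blast
  have "maximal_submod R M {x \<in> carrier M. f x \<in> P}"
    using P xM by (intro h.is_submod_maximal_preimage)
  then have "x \<in> {x \<in> carrier M. f x \<in> P}" using x unfolding rad_def by blast
  then show False using P(2) by simp
qed

end

section \<open>Pre-radicals and torsion\<close>

lemma pre_radical_submod: "pre_radical R \<alpha> \<Longrightarrow> fg_mod R M \<Longrightarrow> is_submod R M (\<alpha> M)"
  by (simp add: pre_radical_def)

lemma pre_radical_image:
  "pre_radical R \<alpha> \<Longrightarrow> fg_mod R M \<Longrightarrow> fg_mod R N \<Longrightarrow> mod_hom R M N f \<Longrightarrow> f ` \<alpha> M \<subseteq> \<alpha> N"
  by (simp add: pre_radical_def)

text \<open>Applied to the inclusion of \<open>\<beta> N\<close> in \<open>N\<close>, the hypothesis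
  \<open>mono\<close> gives an injective map from \<open>q_\<beta> (\<beta> N)\<close> to
  \<open>q_\<beta> N\<close>. This map is also zero, so its source vanishes.\<close>

lemma pre_radical_idem_of_mono:
  assumes \<beta>: "pre_radical R \<beta>" and N: "fg_mod R N" "fg_mod R (submod N (\<beta> N))"
    and mono: "\<And>M f. fg_mod R M \<Longrightarrow> mod_hom R M N f \<Longrightarrow> inj_on f (carrier M) \<Longrightarrow>
      inj_on (\<lambda>x. qrep N (\<beta> N) (f x)) (carrier (qfun \<beta> M))"
  shows "\<beta> (submod N (\<beta> N)) = \<beta> N"
proof -
  let ?B = "submod N (\<beta> N)"
  interpret N: lmod R N by (rule fg_modD[OF N(1)])
  interpret B: lmod R ?B by (rule fg_modD[OF N(2)])
  note sub = pre_radical_submod[OF \<beta> N(1)] and subB = pre_radical_submod[OF \<beta> N(2)]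
  have inj: "inj_on (qrep N (\<beta> N)) (carrier (qfun \<beta> ?B))"
    using mono[OF N(2), of "\<lambda>x. x"] is_submod_carrierD[OF sub] by (auto simp: mod_hom_def)
  have "x \<in> \<beta> ?B" if x: "x \<in> \<beta> N" for x
  proof -
    have mem: "qrep ?B (\<beta> ?B) u \<in> \<beta> N" if "u \<in> \<beta> N" for u
      using B.qrep_closed[OF subB, of u] that by simp
    have eq: "qrep N (\<beta> N) u = \<zero>\<^bsub>quotmod N (\<beta> N)\<^esub>" if "u \<in> \<beta> N" for u
      using N.qrep_eq_zero_iff[OF sub is_submod_carrierD[OF sub that]] that by simp
    have z: "\<zero>\<^bsub>N\<^esub> \<in> \<beta> N" by (rule is_submod_zero_mem[OF sub])
    have carrier: "qrep ?B (\<beta> ?B) u \<in> carrier (qfun \<beta> ?B)" if "u \<in> \<beta> N" for u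
      unfolding qfun_def B.quotmod_surj[symmetric] submod_sel using that by (rule imageI)
    \<comment> \<open>Representatives modulo \<open>\<beta> ?B\<close> stay in
      \<open>\<beta> N\<close>, so the classes of \<open>x\<close> and of zero have the same image,
      namely zero.\<close>
    have "qrep N (\<beta> N) (qrep ?B (\<beta> ?B) x) = qrep N (\<beta> N) (qrep ?B (\<beta> ?B) \<zero>\<^bsub>N\<^esub>)"
      unfolding eq[OF mem[OF x]] eq[OF mem[OF z]] ..
    then have "qrep ?B (\<beta> ?B) x = qrep ?B (\<beta> ?B) \<zero>\<^bsub>N\<^esub>"
      by (rule inj_onD[OF inj _ carrier[OF x] carrier[OF z]])
    then show ?thesis using B.qrep_eq_zero_iff[OF subB, of x] x by (simp add: quotmod_def)
  qed
  then show ?thesis using is_submod_subset[OF subB] by auto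
qed

text \<open>By functoriality the restriction of \<open>h\<close> to \<open>\<alpha> X\<close> sends
  \<open>\<alpha> (\<alpha> X)\<close> into \<open>\<alpha> B = 0\<close>, and idempotence makes
  this all of \<open>\<alpha> X\<close>.\<close>

lemma pre_radical_killed:
  assumes \<alpha>: "pre_radical R \<alpha>" and X: "fg_mod R X" "fg_mod R (submod X (\<alpha> X))"
    and idem: "\<alpha> (submod X (\<alpha> X)) = \<alpha> X"
    and N: "is_submod R N B" "fg_mod R (submod N B)" "\<alpha> (submod N B) = {\<zero>\<^bsub>N\<^esub>}"
    and h: "mod_hom R X N h" "h ` \<alpha> X \<subseteq> B"
  shows "h ` \<alpha> X \<subseteq> {\<zero>\<^bsub>N\<^esub>}"
proof -
  have "mod_hom R (submod X (\<alpha> X)) (submod N B) h"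
    by (rule mod_hom_submod[OF h(1) pre_radical_submod[OF \<alpha> X(1)] h(2)])
  from pre_radical_image[OF \<alpha> X(2) N(2) this] show ?thesis by (simp add: idem N(3))
qed

lemma fg_Gfun:
  assumes \<beta>: "pre_radical R \<beta>" and M: "fg_mod R M"
  shows "fg_mod R (qfun \<beta> M)" "fg_mod R (Gfun R \<beta> M)"
proof -
  show Q: "fg_mod R (qfun \<beta> M)"
    unfolding qfun_def by (rule fg_quotmod[OF M pre_radical_submod[OF \<beta> M]])
  interpret Q: lmod R "qfun \<beta> M" by (rule fg_modD[OF Q])
  show "fg_mod R (Gfun R \<beta> M)"
    unfolding Gfun_def by (rule fg_quotmod[OF Q Q.is_submod_soc])
qed

text \<open>The hypothesis \<open>killed\<close> says that \<open>A\<close> lands in the socle of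
  \<open>q_\<beta> N\<close>. So \<open>rad_to_soc\<close> applies, and vanishing in
  \<open>q_\<beta> N\<close> is membership in \<open>\<beta> N\<close>.\<close>

lemma rad_to_pre_radical:
  assumes \<beta>: "pre_radical R \<beta>" and A: "lmod R A" and N: "fg_mod R N" and h: "mod_hom R A N h"
    and killed: "\<And>x. x \<in> carrier A \<Longrightarrow>
      qrep (qfun \<beta> N) (soc R (qfun \<beta> N)) (qrep N (\<beta> N) (h x)) = \<zero>\<^bsub>Gfun R \<beta> N\<^esub>"
  shows "h ` rad R A \<subseteq> \<beta> N"
proof
  interpret A: lmod R A by fact
  interpret N: lmod R N by (rule fg_modD[OF N])
  interpret Q: lmod R "qfun \<beta> N" by (rule fg_modD[OF fg_Gfun(1)[OF \<beta> N]])
  note sub = pre_radical_submod[OF \<beta> N]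
  have "mod_hom R N (qfun \<beta> N) (qrep N (\<beta> N))" unfolding qfun_def by (rule N.quotmod_hom[OF sub])
  with h interpret g: lmod_hom R A "qfun \<beta> N" "qrep N (\<beta> N) \<circ> h"
    by unfold_locales (rule mod_hom_comp)
  have im: "(qrep N (\<beta> N) \<circ> h) ` carrier A \<subseteq> soc R (qfun \<beta> N)"
  proof
    fix y assume "y \<in> (qrep N (\<beta> N) \<circ> h) ` carrier A"
    then obtain x where x: "x \<in> carrier A" "y = (qrep N (\<beta> N) \<circ> h) x" by auto
    show "y \<in> soc R (qfun \<beta> N)"
      using killed[OF x(1)] Q.qrep_eq_zero_iff[OF Q.is_submod_soc g.closed[OF x(1)]]
      unfolding x(2) by (simp add: Gfun_def)
  qed
  fix y assume "y \<in> h ` rad R A"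
  then obtain x where x: "x \<in> rad R A" "y = h x" by auto
  have "h x \<in> carrier N" using x(1) is_submod_carrierD[OF A.is_submod_rad] mod_hom_closed[OF h] by auto
  then show "y \<in> \<beta> N"
    using g.rad_to_soc[OF im x(1)] N.qrep_eq_zero_iff[OF sub, of "h x"] x(2) by (simp add: qfun_def)
qed

lemma qfun_trivial_iff:
  assumes "pre_radical R \<beta>" "fg_mod R M"
  shows "carrier (qfun \<beta> M) = {\<zero>\<^bsub>qfun \<beta> M\<^esub>} \<longleftrightarrow> \<beta> M = carrier M"
  unfolding qfun_def
  by (rule lmod.quotmod_trivial_iff[OF fg_modD[OF assms(2)] pre_radical_submod[OF assms]])

section \<open>The canonical maps to the iterates of \<open>G\<close>, and the comparison of
  lengths\<close>

text \<open>These are the maps \<open>p_i\<close>. Each step is kept as two projections because the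
  argument stops at the intermediate module \<open>q_\<beta> (G^i M)\<close>.\<close>

primrec Gproj :: "'a ring \<Rightarrow> (('a, 'u) module \<Rightarrow> 'u set) \<Rightarrow> ('a, 'u) module \<Rightarrow> nat \<Rightarrow> 'u \<Rightarrow> 'u" where
  "Gproj R \<beta> M 0 = id"
| "Gproj R \<beta> M (Suc i) =
    (let N = (Gfun R \<beta> ^^ i) M in
      qrep (qfun \<beta> N) (soc R (qfun \<beta> N)) \<circ> (qrep N (\<beta> N) \<circ> Gproj R \<beta> M i))"

lemma Gproj_hom:
  assumes \<beta>: "pre_radical R \<beta>" and M: "fg_mod R M"
  shows "fg_mod R ((Gfun R \<beta> ^^ i) M) \<and> mod_hom R M ((Gfun R \<beta> ^^ i) M) (Gproj R \<beta> M i)"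
proof (induction i)
  case 0
  show ?case using M by (simp add: mod_hom_def)
next
  case (Suc i)
  let ?N = "(Gfun R \<beta> ^^ i) M"
  from Suc have N: "fg_mod R ?N" and h: "mod_hom R M ?N (Gproj R \<beta> M i)" by auto
  interpret N: lmod R ?N by (rule fg_modD[OF N])
  interpret Q: lmod R "qfun \<beta> ?N" by (rule fg_modD[OF fg_Gfun(1)[OF \<beta> N]])
  have "mod_hom R ?N (qfun \<beta> ?N) (qrep ?N (\<beta> ?N))"
    unfolding qfun_def by (rule N.quotmod_hom[OF pre_radical_submod[OF \<beta> N]])
  moreover have "mod_hom R (qfun \<beta> ?N) (Gfun R \<beta> ?N) (qrep (qfun \<beta> ?N) (soc R (qfun \<beta> ?N)))"
    unfolding Gfun_def[of R \<beta> ?N] by (rule Q.quotmod_hom[OF Q.is_submod_soc])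
  ultimately show ?case
    using fg_Gfun(2)[OF \<beta> N] mod_hom_comp[OF mod_hom_comp[OF h]] by (simp add: Let_def comp_def)
qed

theorem theorem2p6:
  fixes R :: "'a ring"
    and \<alpha> \<beta> :: "('a, 'u) module \<Rightarrow> 'u set"
  assumes "left_artinian R"
    and "pre_radical R \<alpha>" and "pre_radical R \<beta>"
    and "\<forall>M. fg_mod R M \<longrightarrow> \<alpha> (submod M (\<alpha> M)) = \<alpha> M"
    and "\<forall>M N f. fg_mod R M \<and> fg_mod R N \<and> mod_hom R M N f \<and> inj_on f (carrier M) \<longrightarrow>
           inj_on (\<lambda>x. qrep N (\<beta> N) (f x)) (carrier (qfun \<beta> M))"
  shows "(\<forall>M. fg_mod R M \<longrightarrow> ll_up R \<alpha> M \<le> ll_low_q R \<beta> M) \<longleftrightarrow>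
         (\<forall>M. fg_mod R M \<and> \<beta> M = carrier M \<longrightarrow> \<alpha> M = {\<zero>\<^bsub>M\<^esub>})"
proof (intro iffI allI impI)
  fix M :: "('a, 'u) module"
  assume le: "\<forall>M. fg_mod R M \<longrightarrow> ll_up R \<alpha> M \<le> ll_low_q R \<beta> M"
    and M: "fg_mod R M \<and> \<beta> M = carrier M"
  let ?P = "\<lambda>i. \<alpha> ((Ffun R \<alpha> ^^ i) M) = {zero ((Ffun R \<alpha> ^^ i) M)}"
  let ?Q = "\<lambda>i. carrier (qfun \<beta> ((Gfun R \<beta> ^^ i) M)) = {zero (qfun \<beta> ((Gfun R \<beta> ^^ i) M))}"
  \<comment> \<open>For \<open>\<beta> M = M\<close> the module \<open>q_\<beta> M\<close> is zero,
    so the lower length is 0. The inequality forces the upper length to be 0, which says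
    \<open>\<alpha> M = 0\<close>.\<close>
  have Q: "?Q 0" using M qfun_trivial_iff[OF assms(3)] by simp
  then have "(LEAST i. ?Q i) = 0" by (rule Least_eq_0)
  with Q have "ll_low_q R \<beta> M = 0" unfolding ll_low_q_def zero_enat_def by metis
  then have "ll_up R \<alpha> M = 0" using le M by (metis ile0_eq)
  then have "(\<exists>i. ?P i) \<and> (LEAST i. ?P i) = 0"
    unfolding ll_up_def by (simp add: zero_enat_def split: if_splits) blast
  then have "?P 0" using LeastI_ex[of ?P] by metis
  then show "\<alpha> M = {\<zero>\<^bsub>M\<^esub>}" by simp
next
  fix M :: "('a, 'u) module"
  assume tf: "\<forall>M. fg_mod R M \<and> \<beta> M = carrier M \<longrightarrow> \<alpha> M = {\<zero>\<^bsub>M\<^esub>}"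
    and M: "fg_mod R M"
  note \<alpha> = assms(2) and \<beta> = assms(3) and fg_sub = fg_submod[OF assms(1)]
  interpret M: lmod R M by (rule fg_modD[OF M])
  define G where "G i = (Gfun R \<beta> ^^ i) M" for i
  define p where "p = Gproj R \<beta> M"
  have G: "fg_mod R (G i)" and p: "mod_hom R M (G i) (p i)" for i
    using Gproj_hom[OF \<beta> M] by (auto simp: G_def p_def)
  have \<beta>_sub: "is_submod R N (\<beta> N)" "fg_mod R (submod N (\<beta> N))" if "fg_mod R N" for N
    using pre_radical_submod[OF \<beta> that] fg_sub[OF that] by auto
  have torsion: "\<alpha> (submod N (\<beta> N)) = {\<zero>\<^bsub>N\<^esub>}" if N: "fg_mod R N" for N
  proof -
    have "\<beta> (submod N (\<beta> N)) = \<beta> N"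
      using assms(5) N by (intro pre_radical_idem_of_mono[OF \<beta> N \<beta>_sub(2)[OF N]]) auto
    then show ?thesis using tf \<beta>_sub(2)[OF N] by simp
  qed
  have killed: "h ` \<alpha> X \<subseteq> {\<zero>\<^bsub>N\<^esub>}"
    if "fg_mod R X" "fg_mod R N" "mod_hom R X N h" "h ` carrier X \<subseteq> \<beta> N" for X N h
  proof (rule pre_radical_killed[OF \<alpha> _ _ _ \<beta>_sub torsion])
    show "h ` \<alpha> X \<subseteq> \<beta> N" using that is_submod_subset[OF pre_radical_submod[OF \<alpha>]] by blast
    show "fg_mod R (submod X (\<alpha> X))" by (rule fg_sub[OF that(1) pre_radical_submod[OF \<alpha> that(1)]])
  qed (use that assms(4) in auto)

  show "ll_up R \<alpha> M \<le> ll_low_q R \<beta> M"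
  proof (cases "ll_low_q R \<beta> M")
    case (enat n)
    let ?Q = "\<lambda>i. carrier (qfun \<beta> (G i)) = {zero (qfun \<beta> (G i))}"
    have "\<exists>i. ?Q i" and n: "n = (LEAST i. ?Q i)"
      using enat unfolding ll_low_q_def G_def by (simp_all split: if_splits) blast
    then have "?Q n" using LeastI_ex[of ?Q] by metis
    then have top: "\<beta> (G n) = carrier (G n)" using qfun_trivial_iff[OF \<beta> G] by simp
    \<comment> \<open>The witness \<open>Y\<close> realises \<open>F^j M\<close> inside
      \<open>M\<close> itself, as nested \<open>submod\<close> records collapse. Every
      \<open>p i\<close> therefore restricts to it.\<close>
    have step: "\<exists>Y. is_submod R M Y \<and> (Ffun R \<alpha> ^^ j) M = submod M Y \<and> p (n - j) ` Y \<subseteq> \<beta> (G (n - j))"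
      if "j \<le> n" for j
      using that
    proof (induction j)
      case 0
      have "p n ` carrier M \<subseteq> \<beta> (G n)" unfolding top using mod_hom_closed[OF p] by auto
      then show ?case using M.is_submod_carrier by (intro exI[of _ "carrier M"]) auto
    next
      case (Suc j)
      then obtain Y where Y: "is_submod R M Y" "(Ffun R \<alpha> ^^ j) M = submod M Y"
        "p (n - j) ` Y \<subseteq> \<beta> (G (n - j))" by auto
      \<comment> \<open>The index drops by one because vanishing in \<open>G (Suc i)\<close> is a
        statement about the socle of \<open>q_\<beta> (G i)\<close>.\<close>
      define i where "i = n - Suc j"
      have i: "n - j = Suc i" using Suc.prems by (simp add: i_def)
      have fgY: "fg_mod R (submod M Y)" by (rule fg_sub[OF M Y(1)])
      define A where "A = \<alpha> (submod M Y)"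
      have A: "is_submod R M A" "A \<subseteq> Y"
        using pre_radical_submod[OF \<alpha> fgY] by (auto simp: A_def M.is_submod_submod[OF Y(1)])
      interpret A: lmod R "submod M A" by (rule M.lmod_submod[OF A(1)])
      have radA: "is_submod R M (rad R (submod M A))"
        using A.is_submod_rad by (simp add: M.is_submod_submod[OF A(1)])
      have "mod_hom R (submod M Y) (G (Suc i)) (p (Suc i))"
        using mod_hom_submod[OF p[of "Suc i"] Y(1), of "carrier (G (Suc i))"]
          mod_hom_closed[OF p] is_submod_carrierD[OF Y(1)] by auto
      then have "p (Suc i) ` A \<subseteq> {\<zero>\<^bsub>G (Suc i)\<^esub>}"
        unfolding A_def using Y(3) i by (intro killed fgY G) auto
      then have z: "p (Suc i) x = \<zero>\<^bsub>G (Suc i)\<^esub>" if "x \<in> A" for x using that by auto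
      have "p i ` rad R (submod M A) \<subseteq> \<beta> (G i)"
      proof (rule rad_to_pre_radical[OF \<beta> A.lmod_axioms G])
        show "mod_hom R (submod M A) (G i) (p i)"
          using mod_hom_submod[OF p[of i] A(1), of "carrier (G i)"]
            mod_hom_closed[OF p] is_submod_carrierD[OF A(1)] by auto
        \<comment> \<open>This composite is \<open>p (Suc i)\<close> by its recursion, and that map
          vanishes on \<open>A\<close>.\<close>
        show "qrep (qfun \<beta> (G i)) (soc R (qfun \<beta> (G i))) (qrep (G i) (\<beta> (G i)) (p i x)) =
            \<zero>\<^bsub>Gfun R \<beta> (G i)\<^esub>" if "x \<in> carrier (submod M A)" for x
          using z[of x] that by (simp add: p_def G_def Let_def)
      qed
      moreover have "(Ffun R \<alpha> ^^ Suc j) M = submod M (rad R (submod M A))"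
        by (simp add: Y(2) Ffun_def A_def)
      ultimately show ?case using radA i_def by blast
    qed
    \<comment> \<open>At \<open>j = n\<close> the index is 0, where \<open>p 0\<close> is the
      identity and \<open>G 0 = M\<close>.\<close>
    obtain Y where Y: "is_submod R M Y" "(Ffun R \<alpha> ^^ n) M = submod M Y" "Y \<subseteq> \<beta> M"
      using step[of n] by (auto simp: p_def G_def)
    have fgY: "fg_mod R (submod M Y)" by (rule fg_sub[OF M Y(1)])
    \<comment> \<open>The identity serves as the inclusion of \<open>Y\<close> in \<open>M\<close>,
      with image in \<open>\<beta> M\<close>, so \<open>killed\<close> applies once more.\<close>
    have "(\<lambda>x. x) ` \<alpha> (submod M Y) \<subseteq> {\<zero>\<^bsub>M\<^esub>}"
      using Y is_submod_carrierD[OF Y(1)] by (intro killed fgY M) (auto simp: mod_hom_def)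
    moreover have "\<zero>\<^bsub>M\<^esub> \<in> \<alpha> (submod M Y)"
      using is_submod_zero_mem[OF pre_radical_submod[OF \<alpha> fgY]] by simp
    ultimately have "\<alpha> (submod M Y) = {\<zero>\<^bsub>M\<^esub>}" by auto
    then have "\<alpha> ((Ffun R \<alpha> ^^ n) M) = {zero ((Ffun R \<alpha> ^^ n) M)}" by (simp add: Y(2))
    then have "ll_up R \<alpha> M \<le> enat n"
      unfolding ll_up_def by (auto intro: Least_le)
    then show ?thesis by (simp add: enat)
  qed simp
qed

end
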